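(* Let $\alpha>1$, $\beta=\alpha-1$, and let $\mathsf{E}_\alpha:\mathcal{P}_2(\mathbb{R}^d)\times\mathcal{P}_2(\mathbb{R}^d)\to\mathcal{P}_2(\mathbb{R}^d)$ be the metric extrapolation, $$\mathsf{E}_\alpha(\mu_0,\mu_1):=\operatorname*{argmin}_{\rho\in\mathcal{P}_2(\mathbb{R}^d)}\ \alpha W_2^2(\rho,\mu_1)-\beta W_2^2(\rho,\mu_0).$$ Then $\mathsf{E}_\alpha$ verifies the consistency assumption for all $\varphi\in C_c^\infty(\mathbb{R}^d)$: for every $\varphi\in C_c^\infty(\mathbb{R}^d)$ there is a constant $C_\varphi>0$, depending only on $\alpha$, $\varphi$ and $\Omega$, such that for all $\mu_0,\mu_1\in\mathcal{P}(\Omega)$, $$\left|\int_{\mathbb{R}^d}\varphi\,\big(\mathsf{E}_\alpha(\mu_0,\mu_1)-\alpha\mu_1+\beta\mu_0\big)\right|\le C_\varphi W_2^2(\mu_0,\mu_1).$$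
   Context: $\Omega\subset\mathbb{R}^d$ is a convex compact domain. $\mathcal{P}_2(\mathbb{R}^d)$ is the set of probability measures on $\mathbb{R}^d$ with finite second moment; $\mathcal{P}(\Omega)$ is the set of probability measures on $\Omega$, seen as a subset of $\mathcal{P}_2(\mathbb{R}^d)$; $W_2$ is the quadratic Wasserstein distance. The minimization problem defining the metric extrapolation always has a unique solution. *)

theory Defs
  imports "HOL-Probability.Probability"
begin

definition P2 :: "'a::euclidean_space measure set" where
  "P2 = {\<mu>. prob_space \<mu> \<and> sets \<mu> = sets borel \<and> integrable \<mu> (\<lambda>x. (norm x)\<^sup>2)}"

text \<open>Probability measures on \<open>\<Omega>\<close> are viewed as measures on the whole space concentrated on \<open>\<Omega>\<close>.
  For compact \<open>\<Omega>\<close> the second-moment condition is automatic.\<close>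
definition P_on :: "'a::euclidean_space set \<Rightarrow> 'a measure set" where
  "P_on \<Omega> = {\<mu> \<in> P2. measure \<mu> \<Omega> = 1}"

definition couplings :: "'a::euclidean_space measure \<Rightarrow> 'a measure \<Rightarrow> ('a \<times> 'a) measure set" where
  "couplings \<mu> \<nu> =
     {\<gamma>. sets \<gamma> = sets (borel \<Otimes>\<^sub>M borel) \<and> distr \<gamma> borel fst = \<mu> \<and> distr \<gamma> borel snd = \<nu>}"

text \<open>The infimum is taken in \<open>ennreal\<close> and is finite whenever both measures lie in \<^const>\<open>P2\<close>
  (use the product coupling).\<close>
definition W2 :: "'a::euclidean_space measure \<Rightarrow> 'a measure \<Rightarrow> real" where
  "W2 \<mu> \<nu> = sqrt (enn2real
     (INF \<gamma>\<in>couplings \<mu> \<nu>. \<integral>\<^sup>+ z. ennreal ((dist (fst z) (snd z))\<^sup>2) \<partial>\<gamma>))"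

text \<open>\<open>is_metric_extrapolation \<alpha> \<mu>\<^sub>0 \<mu>\<^sub>1 \<rho>\<close> expresses \<open>\<rho> = E\<^sub>\<alpha>(\<mu>\<^sub>0, \<mu>\<^sub>1)\<close>: the minimizer exists and is unique
  for all \<open>\<alpha> > 1\<close> and \<open>\<mu>\<^sub>0, \<mu>\<^sub>1\<close> in \<^const>\<open>P2\<close>, so this relation is the graph of the map \<open>E\<^sub>\<alpha>\<close>.\<close>
definition is_metric_extrapolation ::
    "real \<Rightarrow> 'a::euclidean_space measure \<Rightarrow> 'a measure \<Rightarrow> 'a measure \<Rightarrow> bool" where
  "is_metric_extrapolation \<alpha> \<mu>\<^sub>0 \<mu>\<^sub>1 \<rho> \<longleftrightarrow>
     is_arg_min (\<lambda>\<rho>. \<alpha> * (W2 \<rho> \<mu>\<^sub>1)\<^sup>2 - (\<alpha> - 1) * (W2 \<rho> \<mu>\<^sub>0)\<^sup>2) (\<lambda>\<rho>. \<rho> \<in> P2) \<rho>"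

primrec Ck :: "nat \<Rightarrow> ('a::euclidean_space \<Rightarrow> real) \<Rightarrow> bool" where
  "Ck 0 f \<longleftrightarrow> continuous_on UNIV f"
| "Ck (Suc k) f \<longleftrightarrow> f differentiable_on UNIV \<and>
     (\<forall>b\<in>Basis. Ck k (\<lambda>x. frechet_derivative f (at x) b))"

definition Cc_infinity :: "('a::euclidean_space \<Rightarrow> real) set" where
  "Cc_infinity = {\<phi>. (\<forall>k. Ck k \<phi>) \<and> compact (closure {x. \<phi> x \<noteq> 0})}"

end

theory Submission
  imports Defs
begin

text \<open>Let \<open>\<rho>\<close> be the extrapolation and take nearly optimal couplings \<open>(X, Y)\<close> of \<open>(\<rho>, \<mu>\<^sub>1)\<close> and
  \<open>(X + t \<nabla>\<phi>(Y), Z)\<close> of the perturbed measure with \<open>\<mu>\<^sub>0\<close>, glued into one triple \<open>(X, Y, Z)\<close>. Minimality of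
  \<open>\<rho>\<close> against the law of \<open>X + t \<nabla>\<phi>(Y)\<close> gives \<open>E[\<nabla>\<phi>(Y) \<bullet> (X - \<alpha> Y + \<beta> Z)] \<ge> - O(t)\<close>, and this is the
  first-order part of \<open>E[\<phi>(X) - \<alpha> \<phi>(Y) + \<beta> \<phi>(Z)]\<close> expanded at \<open>Y\<close>. The second-order remainders
  are controlled by \<open>E|X - Y|\<^sup>2\<close> and \<open>E|Y - Z|\<^sup>2\<close>, which are \<open>O(W\<^sub>2\<^sup>2(\<mu>\<^sub>0, \<mu>\<^sub>1))\<close> because minimality against
  \<open>\<mu>\<^sub>1\<close> yields \<open>W\<^sub>2(\<rho>, \<mu>\<^sub>1) \<le> 2 \<beta> W\<^sub>2(\<mu>\<^sub>0, \<mu>\<^sub>1)\<close>. Letting \<open>t\<close> tend to \<open>0\<close> bounds the error from below; \<open>-\<phi>\<close>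
  gives the upper bound. Near-optimal couplings and gluing up to a small error, along a countable
  partition into small cells, make both the existence of optimal plans and disintegration unnecessary.\<close>

section \<open>Couplings\<close>

lemma AE_fiber_not_null:
  fixes k :: "'m \<Rightarrow> nat"
  assumes [measurable]: "k \<in> measurable M (count_space UNIV)"
  shows "AE m in M. emeasure M {x \<in> space M. k x = k m} \<noteq> 0"
proof -
  \<comment> \<open>There are only countably many labels, so the null fibers can be discarded one at
    a time.\<close>
  have "AE m in M. \<forall>j. emeasure M {x \<in> space M. k x = j} = 0 \<longrightarrow> k m \<noteq> j"
  proof (subst AE_all_countable, intro allI)
    fix j
    show "AE m in M. emeasure M {x \<in> space M. k x = j} = 0 \<longrightarrow> k m \<noteq> j"
      by (cases "emeasure M {x \<in> space M. k x = j} = 0")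
        (auto intro: AE_I[where N="{x \<in> space M. k x = j}"])
  qed
  then show ?thesis by auto
qed

text \<open>Conditionally on the common label, the two points are drawn independently. As labels are
  countable, this is an explicit density with respect to the product measure, and no conditional
  kernels are required. It replaces exact gluing along a shared marginal.\<close>

lemma exists_coupling_agreeing_on_index:
  fixes k :: "'m \<Rightarrow> nat" and l :: "'n \<Rightarrow> nat"
  assumes M: "prob_space M" and N: "prob_space N"
    and [measurable]: "k \<in> measurable M (count_space UNIV)" "l \<in> measurable N (count_space UNIV)"
    and eq: "distr M (count_space UNIV) k = distr N (count_space UNIV) l"
  shows "\<exists>P. sets P = sets (M \<Otimes>\<^sub>M N) \<and> distr P M fst = M \<and> distr P N snd = N \<and>
           (AE z in P. k (fst z) = l (snd z))"
proof -
  interpret M: prob_space M by fact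
  interpret N: prob_space N by fact
  interpret MN: pair_prob_space M N ..
  define p where "p j = emeasure M {m \<in> space M. k m = j}" for j
  have p2: "p j = emeasure N {n \<in> space N. l n = j}" for j
  proof -
    have "p j = emeasure (distr M (count_space UNIV) k) {j}"
      unfolding p_def by (subst emeasure_distr) (auto intro!: arg_cong[where f="emeasure M"])
    also have "\<dots> = emeasure N {n \<in> space N. l n = j}"
      unfolding eq by (subst emeasure_distr) (auto intro!: arg_cong[where f="emeasure N"])
    finally show ?thesis .
  qed
  have pfin: "p j < \<top>" for j unfolding p_def by (simp add: less_top[symmetric])
  \<comment> \<open>Independent coupling inside each cell \<open>{k = j} \<times> {l = j}\<close>; the factor restores the marginals.\<close>
  define h where "h z = (if k (fst z) = l (snd z) then inverse (p (k (fst z))) else 0)" for z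
  have [measurable]: "h \<in> borel_measurable (M \<Otimes>\<^sub>M N)"
  proof -
    have [measurable]: "(\<lambda>z. inverse (p (k (fst z)))) \<in> borel_measurable (M \<Otimes>\<^sub>M N)"
      by (rule measurable_compose[where N="count_space UNIV" and f="\<lambda>z. k (fst z)" and g="\<lambda>j. inverse (p j)"]) measurable
    \<comment> \<open>Equality of labels is written as a countable union over \<open>j\<close>, a
      form in which measurability is automatic.\<close>
    have "Measurable.pred (M \<Otimes>\<^sub>M N) (\<lambda>z. \<exists>j. k (fst z) = j \<and> l (snd z) = j)"
      by measurable
    then have [measurable]: "Measurable.pred (M \<Otimes>\<^sub>M N) (\<lambda>z. k (fst z) = l (snd z))"
      by (simp add: eq_commute)
    show ?thesis unfolding h_def by measurable
  qed
  define P where "P = density (M \<Otimes>\<^sub>M N) h"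
  have sP: "sets P = sets (M \<Otimes>\<^sub>M N)" by (simp add: P_def)
  \<comment> \<open>In \<open>ennreal\<close> the inverse of 0 is infinite and infinity times 0 is
    0, so the normalisation \<open>inv\<close> fails on cells of mass zero. These cells are
    negligible on either side.\<close>
  have nullM: "AE m in M. p (k m) \<noteq> 0"
    unfolding p_def by (rule AE_fiber_not_null) measurable
  have nullN: "AE n in N. p (l n) \<noteq> 0"
    unfolding p2 by (rule AE_fiber_not_null) measurable
  have iN: "(\<integral>\<^sup>+n. h (m, n) \<partial>N) = inverse (p (k m)) * p (k m)" for m
  proof -
    have "(\<integral>\<^sup>+n. h (m, n) \<partial>N) = (\<integral>\<^sup>+n. inverse (p (k m)) * indicator {n \<in> space N. l n = k m} n \<partial>N)"
      by (intro nn_integral_cong) (auto simp: h_def)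
    then show ?thesis by (simp add: nn_integral_cmult_indicator p2)
  qed
  have iM: "(\<integral>\<^sup>+m. h (m, n) \<partial>M) = inverse (p (l n)) * p (l n)" for n
  proof -
    have "(\<integral>\<^sup>+m. h (m, n) \<partial>M) = (\<integral>\<^sup>+m. inverse (p (l n)) * indicator {m \<in> space M. k m = l n} m \<partial>M)"
      by (intro nn_integral_cong) (auto simp: h_def)
    then show ?thesis by (simp add: nn_integral_cmult_indicator p_def)
  qed
  have inv: "inverse (p j) * p j = 1" if "p j \<noteq> 0" for j
    using that pfin[of j] by (metis ennreal_divide_self divide_ennreal_def mult.commute)
  have m1: "distr P M fst = M"
  proof (rule measure_eqI)
    fix B assume "B \<in> sets (distr P M fst)"
    then have B[measurable]: "B \<in> sets M" by simp
    have "emeasure (distr P M fst) B = emeasure P (B \<times> space N)"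
      using sets.sets_into_space[OF B]
      by (subst emeasure_distr) (auto simp: P_def space_pair_measure intro!: arg_cong[where f="emeasure _"])
    also have "\<dots> = (\<integral>\<^sup>+z. h z * indicator (B \<times> space N) z \<partial>(M \<Otimes>\<^sub>M N))"
      unfolding P_def by (subst emeasure_density) auto
    also have "\<dots> = (\<integral>\<^sup>+m. (\<integral>\<^sup>+n. h (m,n) * indicator (B \<times> space N) (m,n) \<partial>N) \<partial>M)"
      by (subst N.nn_integral_fst[symmetric]) auto
    also have "\<dots> = (\<integral>\<^sup>+m. (\<integral>\<^sup>+n. h (m,n) * indicator B m \<partial>N) \<partial>M)"
      by (intro nn_integral_cong) (auto simp: indicator_def)
    also have "\<dots> = (\<integral>\<^sup>+m. inverse (p (k m)) * p (k m) * indicator B m \<partial>M)"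
      by (intro nn_integral_cong, subst nn_integral_multc) (auto simp: iN)
    also have "\<dots> = (\<integral>\<^sup>+m. indicator B m \<partial>M)"
      by (rule nn_integral_cong_AE) (use nullM in \<open>auto simp: inv\<close>)
    also have "\<dots> = emeasure M B" by simp
    finally show "emeasure (distr P M fst) B = emeasure M B" .
  qed simp
  have m2: "distr P N snd = N"
  proof (rule measure_eqI)
    fix B assume "B \<in> sets (distr P N snd)"
    then have B[measurable]: "B \<in> sets N" by simp
    have "emeasure (distr P N snd) B = emeasure P (space M \<times> B)"
      using sets.sets_into_space[OF B]
      by (subst emeasure_distr) (auto simp: P_def space_pair_measure intro!: arg_cong[where f="emeasure _"])
    also have "\<dots> = (\<integral>\<^sup>+z. h z * indicator (space M \<times> B) z \<partial>(M \<Otimes>\<^sub>M N))"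
      unfolding P_def by (subst emeasure_density) auto
    also have "\<dots> = (\<integral>\<^sup>+n. (\<integral>\<^sup>+m. h (m,n) * indicator (space M \<times> B) (m,n) \<partial>M) \<partial>N)"
      by (subst MN.nn_integral_snd[symmetric]) auto
    also have "\<dots> = (\<integral>\<^sup>+n. (\<integral>\<^sup>+m. h (m,n) * indicator B n \<partial>M) \<partial>N)"
      by (intro nn_integral_cong) (auto simp: indicator_def)
    also have "\<dots> = (\<integral>\<^sup>+n. inverse (p (l n)) * p (l n) * indicator B n \<partial>N)"
      by (intro nn_integral_cong, subst nn_integral_multc) (auto simp: iM)
    also have "\<dots> = (\<integral>\<^sup>+n. indicator B n \<partial>N)"
      by (rule nn_integral_cong_AE) (use nullN in \<open>auto simp: inv\<close>)
    also have "\<dots> = emeasure N B" by simp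
    finally show "emeasure (distr P N snd) B = emeasure N B" .
  qed simp
  have "AE z in P. k (fst z) = l (snd z)"
    unfolding P_def by (subst AE_density) (auto simp: h_def)
  with sP m1 m2 show ?thesis by blast
qed

text \<open>A point is labelled by the first member of a countable dense sequence within
  \<open>e / 2\<close> of it; points sharing a label are then within \<open>e\<close> by the
  triangle inequality.\<close>

lemma ex_countable_index:
  fixes e :: real
  assumes "e > 0"
  shows "\<exists>k :: 'a::euclidean_space \<Rightarrow> nat. k \<in> measurable borel (count_space UNIV) \<and>
           (\<forall>x y. k x = k y \<longrightarrow> dist x y \<le> e)"
proof -
  obtain D :: "'a set" where D: "countable D" "\<And>X. open X \<Longrightarrow> X \<noteq> {} \<Longrightarrow> \<exists>d\<in>D. d \<in> X"
    by (rule countable_dense_setE) blast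
  have ne: "D \<noteq> {}" using D(2)[of UNIV] by auto
  define k where "k x = (LEAST i. dist (from_nat_into D i) x < e / 2)" for x
  have ex: "\<exists>i. dist (from_nat_into D i) x < e / 2" for x
  proof -
    obtain d where "d \<in> D" "d \<in> ball x (e/2)" using D(2)[of "ball x (e/2)"] assms by auto
    moreover obtain i where "from_nat_into D i = d"
      using from_nat_into_surj[OF D(1) \<open>d \<in> D\<close>] by auto
    ultimately show ?thesis by (auto simp: dist_commute)
  qed
  have kx: "dist (from_nat_into D (k x)) x < e / 2" for x
    unfolding k_def by (rule LeastI_ex[OF ex])
  have "k \<in> measurable borel (count_space UNIV)"
    unfolding k_def by measurable
  moreover have "dist x y \<le> e" if "k x = k y" for x y
    using dist_triangle_half_r[of "from_nat_into D (k x)" x e y] kx[of x] kx[of y] that by auto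
  ultimately show ?thesis by blast
qed

section \<open>Wasserstein cost in terms of random variables, and near-optimal couplings\<close>

lemma W2_sq: "(W2 \<mu> \<nu>)\<^sup>2 = enn2real
     (INF \<gamma>\<in>couplings \<mu> \<nu>. \<integral>\<^sup>+ z. ennreal ((dist (fst z) (snd z))\<^sup>2) \<partial>\<gamma>)"
  by (simp add: W2_def)

text \<open>The joint law of \<open>X\<close> and \<open>Y\<close> is an admissible coupling.
  Integrability makes the real integral equal to the \<open>ennreal\<close> cost; without it the
  Bochner integral would be the default value 0.\<close>

lemma W2_sq_le:
  fixes X Y :: "'m \<Rightarrow> 'a::euclidean_space"
  assumes [measurable]: "X \<in> borel_measurable M" "Y \<in> borel_measurable M"
    and X: "distr M borel X = \<mu>" and Y: "distr M borel Y = \<nu>"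
    and int: "integrable M (\<lambda>z. (dist (X z) (Y z))\<^sup>2)"
  shows "(W2 \<mu> \<nu>)\<^sup>2 \<le> (\<integral>z. (dist (X z) (Y z))\<^sup>2 \<partial>M)"
proof -
  define \<gamma> where "\<gamma> = distr M (borel \<Otimes>\<^sub>M borel) (\<lambda>z. (X z, Y z))"
  have \<gamma>: "\<gamma> \<in> couplings \<mu> \<nu>"
    unfolding couplings_def \<gamma>_def using X Y
    by (auto simp: distr_distr comp_def)
  have "(INF \<gamma>\<in>couplings \<mu> \<nu>. \<integral>\<^sup>+ z. ennreal ((dist (fst z) (snd z))\<^sup>2) \<partial>\<gamma>)
      \<le> (\<integral>\<^sup>+ z. ennreal ((dist (fst z) (snd z))\<^sup>2) \<partial>\<gamma>)"
    by (rule INF_lower) fact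
  also have "\<dots> = (\<integral>\<^sup>+ z. ennreal ((dist (X z) (Y z))\<^sup>2) \<partial>M)"
    unfolding \<gamma>_def by (subst nn_integral_distr) auto
  also have "\<dots> = ennreal (\<integral>z. (dist (X z) (Y z))\<^sup>2 \<partial>M)"
    by (rule nn_integral_eq_integral[OF int]) auto
  finally show ?thesis
    unfolding W2_sq by (intro enn2real_leI) auto
qed

text \<open>Young's inequality applied to the cross term of the squared triangle inequality. For
  small \<open>d\<close> the first factor is close to 1, so one distance can be kept almost without
  loss if the other is much smaller.\<close>

lemma dist_sq_le_weighted:
  fixes x y z :: "'a::real_normed_vector"
  assumes "d > 0"
  shows "(dist x z)\<^sup>2 \<le> (1 + d) * (dist x y)\<^sup>2 + (1 + 1 / d) * (dist y z)\<^sup>2"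
proof -
  have "(dist x z)\<^sup>2 \<le> (dist x y + dist y z)\<^sup>2"
    by (intro power_mono dist_triangle) auto
  also have "\<dots> \<le> (1 + d) * (dist x y)\<^sup>2 + (1 + 1 / d) * (dist y z)\<^sup>2"
  proof -
    have "0 \<le> (d * dist x y - dist y z)\<^sup>2 / d" using assms by simp
    also have "\<dots> = d * (dist x y)\<^sup>2 + (dist y z)\<^sup>2 / d - 2 * dist x y * dist y z"
      using assms by (simp add: power2_eq_square field_simps)
    finally show ?thesis by (simp add: power2_sum algebra_simps)
  qed
  finally show ?thesis .
qed

lemma dist_sq_le_twice:
  fixes x y z :: "'a::real_normed_vector"
  shows "(dist x z)\<^sup>2 \<le> 2 * (dist x y)\<^sup>2 + 2 * (dist y z)\<^sup>2"
  using dist_sq_le_weighted[of 1 x z y] by simp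

lemma integrable_dist_sq:
  fixes X Y :: "'m \<Rightarrow> 'a::euclidean_space"
  assumes [measurable]: "X \<in> borel_measurable M" "Y \<in> borel_measurable M"
    and int: "integrable M (\<lambda>z. (norm (X z))\<^sup>2)" "integrable M (\<lambda>z. (norm (Y z))\<^sup>2)"
  shows "integrable M (\<lambda>z. (dist (X z) (Y z))\<^sup>2)"
proof (rule Bochner_Integration.integrable_bound)
  show "integrable M (\<lambda>z. 2 * (norm (X z))\<^sup>2 + 2 * (norm (Y z))\<^sup>2)"
    using int by auto
  show "AE z in M. norm ((dist (X z) (Y z))\<^sup>2) \<le> norm (2 * (norm (X z))\<^sup>2 + 2 * (norm (Y z))\<^sup>2)"
    using dist_sq_le_twice[of "X _" "Y _" 0] by auto
qed measurable

lemma P2_distrI: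
  fixes X :: "'m \<Rightarrow> 'a::euclidean_space"
  assumes "prob_space M" and [measurable]: "X \<in> borel_measurable M"
    and "integrable M (\<lambda>z. (norm (X z))\<^sup>2)"
  shows "distr M borel X \<in> P2"
  using assms by (auto simp: P2_def integrable_distr_eq intro: prob_space.prob_space_distr)

lemma P2_distrD:
  fixes X :: "'m \<Rightarrow> 'a::euclidean_space"
  assumes "distr M borel X \<in> P2" and [measurable]: "X \<in> borel_measurable M"
  shows "integrable M (\<lambda>z. (norm (X z))\<^sup>2)"
  using assms by (auto simp: P2_def integrable_distr_eq)

text \<open>The product coupling has finite cost because both second moments are finite. Hence the
  infimum is finite, and some coupling lies strictly below it plus \<open>e\<close>.\<close>

lemma near_optimal_coupling:
  fixes \<mu> \<nu> :: "'a::euclidean_space measure"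
  assumes \<mu>: "\<mu> \<in> P2" and \<nu>: "\<nu> \<in> P2" and e: "e > 0"
  shows "\<exists>\<gamma>\<in>couplings \<mu> \<nu>. (\<integral>z. (dist (fst z) (snd z))\<^sup>2 \<partial>\<gamma>) \<le> (W2 \<mu> \<nu>)\<^sup>2 + e"
proof -
  interpret M: prob_space \<mu> using \<mu> by (simp add: P2_def)
  interpret N: prob_space \<nu> using \<nu> by (simp add: P2_def)
  have sb[measurable_cong]: "sets \<mu> = sets borel" "sets \<nu> = sets borel"
    using \<mu> \<nu> by (auto simp: P2_def)
  have fin: "integrable \<gamma> (\<lambda>z. (dist (fst z) (snd z))\<^sup>2)"
    if "\<gamma> \<in> couplings \<mu> \<nu>" for \<gamma>
  proof -
    have [measurable_cong]: "sets \<gamma> = sets (borel \<Otimes>\<^sub>M borel)"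
      using that by (simp add: couplings_def)
    show ?thesis
      using that \<mu> \<nu> by (intro integrable_dist_sq P2_distrD) (auto simp: couplings_def)
  qed
  have prod: "\<mu> \<Otimes>\<^sub>M \<nu> \<in> couplings \<mu> \<nu>"
  proof -
    have "distr (\<mu> \<Otimes>\<^sub>M \<nu>) borel fst = distr (\<mu> \<Otimes>\<^sub>M \<nu>) \<mu> fst"
      by (rule distr_cong) (auto simp: sb)
    moreover have "distr (\<mu> \<Otimes>\<^sub>M \<nu>) borel snd = distr (\<mu> \<Otimes>\<^sub>M \<nu>) \<nu> snd"
      by (rule distr_cong) (auto simp: sb)
    moreover have "distr (\<mu> \<Otimes>\<^sub>M \<nu>) \<nu> snd = \<nu>"
    proof (rule measure_eqI)
      fix A assume "A \<in> sets (distr (\<mu> \<Otimes>\<^sub>M \<nu>) \<nu> snd)"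
      then have A: "A \<in> sets \<nu>" by simp
      then have "snd -` A \<inter> space (\<mu> \<Otimes>\<^sub>M \<nu>) = space \<mu> \<times> A"
        using sets.sets_into_space by (auto simp: space_pair_measure)
      then show "emeasure (distr (\<mu> \<Otimes>\<^sub>M \<nu>) \<nu> snd) A = emeasure \<nu> A"
        using A by (simp add: emeasure_distr N.emeasure_pair_measure_Times M.emeasure_space_1)
    qed simp
    moreover have "sets (\<mu> \<Otimes>\<^sub>M \<nu>) = sets (borel \<Otimes>\<^sub>M borel)"
      by (rule sets_pair_measure_cong) (auto simp: sb)
    ultimately show ?thesis
      by (simp add: couplings_def N.distr_pair_fst)
  qed
  let ?c = "\<lambda>\<gamma>. \<integral>\<^sup>+ z. ennreal ((dist (fst z) (snd z))\<^sup>2) \<partial>\<gamma>"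
  have c: "?c \<gamma> = ennreal (\<integral>z. (dist (fst z) (snd z))\<^sup>2 \<partial>\<gamma>)" if "\<gamma> \<in> couplings \<mu> \<nu>" for \<gamma>
    by (rule nn_integral_eq_integral[OF fin[OF that]]) auto
  \<comment> \<open>Finiteness matters here: \<open>enn2real\<close> would otherwise turn an
    infinite infimum into 0.\<close>
  have "(INF \<gamma>\<in>couplings \<mu> \<nu>. ?c \<gamma>) \<le> ?c (\<mu> \<Otimes>\<^sub>M \<nu>)"
    by (rule INF_lower) fact
  also have "\<dots> < \<top>" by (simp add: c[OF prod])
  finally have I: "(INF \<gamma>\<in>couplings \<mu> \<nu>. ?c \<gamma>) = ennreal ((W2 \<mu> \<nu>)\<^sup>2)"
    by (simp add: W2_sq)
  also have "\<dots> < ennreal ((W2 \<mu> \<nu>)\<^sup>2 + e)"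
    using e by (simp add: ennreal_less_iff)
  finally obtain \<gamma> where \<gamma>: "\<gamma> \<in> couplings \<mu> \<nu>" "?c \<gamma> < ennreal ((W2 \<mu> \<nu>)\<^sup>2 + e)"
    unfolding INF_less_iff by blast
  then show ?thesis
    by (intro bexI[of _ \<gamma>]) (auto simp: c ennreal_less_iff)
qed

text \<open>Approximate gluing: a near-optimal coupling of the law of \<open>f\<close> with \<nu> is
  transported to \<open>M\<close> itself. The value \<open>f m\<close> is matched with the first
  coordinate of the coupling only up to a small cell, and \<open>e\<close> absorbs the resulting
  error.\<close>

lemma lift_near_optimal_coupling:
  fixes f :: "'m \<Rightarrow> 'a::euclidean_space" and \<nu> :: "'a measure"
  assumes M: "prob_space M" and [measurable]: "f \<in> borel_measurable M"
    and f: "integrable M (\<lambda>m. (norm (f m))\<^sup>2)" and \<nu>: "\<nu> \<in> P2" and e: "e > 0"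
  shows "\<exists>P. sets P = sets (M \<Otimes>\<^sub>M borel) \<and> distr P M fst = M \<and> distr P borel snd = \<nu> \<and>
           (\<integral>z. (dist (f (fst z)) (snd z))\<^sup>2 \<partial>P) \<le> (W2 (distr M borel f) \<nu>)\<^sup>2 + e"
proof -
  define \<mu> where "\<mu> = distr M borel f"
  have \<mu>: "\<mu> \<in> P2" unfolding \<mu>_def by (rule P2_distrI) (use M f in auto)
  obtain \<gamma> where \<gamma>: "\<gamma> \<in> couplings \<mu> \<nu>"
      "(\<integral>z. (dist (fst z) (snd z))\<^sup>2 \<partial>\<gamma>) \<le> (W2 \<mu> \<nu>)\<^sup>2 + e / 2"
    using near_optimal_coupling[OF \<mu> \<nu>, of "e/2"] e by auto
  have [measurable_cong]: "sets \<gamma> = sets (borel \<Otimes>\<^sub>M borel)"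
    and g1: "distr \<gamma> borel fst = \<mu>" and g2: "distr \<gamma> borel snd = \<nu>"
    using \<gamma>(1) by (auto simp: couplings_def)
  have pg: "prob_space \<gamma>"
    by (rule prob_space_distrD[of fst _ borel]) (use \<mu> in \<open>auto simp: g1 P2_def\<close>)
  define c where "c = (\<integral>z. (dist (fst z) (snd z))\<^sup>2 \<partial>\<gamma>)"
  have c0: "c \<ge> 0" by (simp add: c_def)
  \<comment> \<open>The cell size \<eta> also serves as Young weight. The cost rises from
    \<open>c\<close> to \<open>c + \<eta> * (c + \<eta> + 1)\<close>, which for \<eta> at most 1
    exceeds \<open>c\<close> by at most \<open>\<eta> * (c + 2)\<close>, hence by at most
    \<open>e / 2\<close>; the other half of \<open>e\<close> pays for the defect of
    \<gamma>.\<close>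
  define \<eta> where "\<eta> = min 1 (e / (2 * (c + 2)))"
  have \<eta>: "\<eta> > 0" "\<eta> \<le> 1" "\<eta> * (c + 2) \<le> e / 2"
  proof -
    show "\<eta> > 0" "\<eta> \<le> 1" using e c0 by (auto simp: \<eta>_def)
    have "\<eta> * (c + 2) \<le> e / (2 * (c + 2)) * (c + 2)"
      using c0 by (intro mult_right_mono) (auto simp: \<eta>_def)
    also have "\<dots> = e / 2" using c0 by (simp add: field_simps)
    finally show "\<eta> * (c + 2) \<le> e / 2" .
  qed
  obtain k :: "'a \<Rightarrow> nat" where [measurable]: "k \<in> measurable borel (count_space UNIV)"
    and k: "\<And>x y. k x = k y \<Longrightarrow> dist x y \<le> \<eta>"
    using ex_countable_index[OF \<eta>(1), where 'a='a] by blast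
  have "distr M (count_space UNIV) (\<lambda>m. k (f m)) = distr \<mu> (count_space UNIV) k"
    unfolding \<mu>_def by (simp add: distr_distr comp_def)
  also have "\<dots> = distr \<gamma> (count_space UNIV) (\<lambda>z. k (fst z))"
    unfolding g1[symmetric] by (simp add: distr_distr comp_def)
  finally have eq: "distr M (count_space UNIV) (\<lambda>m. k (f m)) = distr \<gamma> (count_space UNIV) (\<lambda>z. k (fst z))" .
  obtain Q where Q[measurable_cong]: "sets Q = sets (M \<Otimes>\<^sub>M \<gamma>)"
    and Q1: "distr Q M fst = M" and Q2: "distr Q \<gamma> snd = \<gamma>"
    and Qk: "AE z in Q. k (f (fst z)) = k (fst (snd z))"
    using exists_coupling_agreeing_on_index[OF M pg _ _ eq] by auto
  have pQ: "prob_space Q"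
    by (rule prob_space_distrD[of fst _ M]) (use M in \<open>auto simp: Q1\<close>)
  interpret Q: prob_space Q by fact
  \<comment> \<open>The first coordinate of \<gamma> was only a bridge between \<open>M\<close> and
    \<nu>, and is now forgotten.\<close>
  define P where "P = distr Q (M \<Otimes>\<^sub>M borel) (\<lambda>z. (fst z, snd (snd z)))"
  have P1: "distr P M fst = M"
    unfolding P_def using Q1 by (simp add: distr_distr comp_def)
  have "distr P borel snd = distr Q borel (\<lambda>z. snd (snd z))"
    unfolding P_def by (simp add: distr_distr comp_def)
  also have "\<dots> = distr (distr Q \<gamma> snd) borel snd"
    by (simp add: distr_distr comp_def)
  also have "\<dots> = \<nu>" by (simp add: Q2 g2)
  finally have P2': "distr P borel snd = \<nu>" .
  have i2: "integrable Q (\<lambda>z. (dist (fst (snd z)) (snd (snd z)))\<^sup>2)"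
  proof -
    have "integrable (distr Q \<gamma> snd) (\<lambda>z. (dist (fst z) (snd z))\<^sup>2)"
      unfolding Q2 using g1 g2 \<mu> \<nu>
      by (intro integrable_dist_sq P2_distrD) auto
    then show ?thesis by (subst (asm) integrable_distr_eq) auto
  qed
  have c2: "(\<integral>z. (dist (fst (snd z)) (snd (snd z)))\<^sup>2 \<partial>Q) = c"
    unfolding c_def by (subst Q2[symmetric], subst integral_distr) auto
  have "(\<integral>z. (dist (f (fst z)) (snd z))\<^sup>2 \<partial>P) = (\<integral>z. (dist (f (fst z)) (snd (snd z)))\<^sup>2 \<partial>Q)"
    unfolding P_def by (subst integral_distr) auto
  also have "\<dots> \<le> (\<integral>z. (1 + 1 / \<eta>) * \<eta>\<^sup>2 + (1 + \<eta>) * (dist (fst (snd z)) (snd (snd z)))\<^sup>2 \<partial>Q)"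
  proof (rule integral_mono_AE)
    have "integrable M (\<lambda>m. (norm (f m))\<^sup>2)" by fact
    then have "integrable Q (\<lambda>z. (norm (f (fst z)))\<^sup>2)"
      by (subst (asm) Q1[symmetric], subst (asm) integrable_distr_eq) auto
    moreover have "integrable Q (\<lambda>z. (norm (snd (snd z)))\<^sup>2)"
      by (rule P2_distrD) (use P2' \<nu> in \<open>auto simp: P_def distr_distr comp_def\<close>)
    ultimately show "integrable Q (\<lambda>z. (dist (f (fst z)) (snd (snd z)))\<^sup>2)"
      by (intro integrable_dist_sq) auto
    show "integrable Q (\<lambda>z. (1 + 1 / \<eta>) * \<eta>\<^sup>2 + (1 + \<eta>) * (dist (fst (snd z)) (snd (snd z)))\<^sup>2)"
      using i2 by auto
    show "AE z in Q. (dist (f (fst z)) (snd (snd z)))\<^sup>2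
        \<le> (1 + 1 / \<eta>) * \<eta>\<^sup>2 + (1 + \<eta>) * (dist (fst (snd z)) (snd (snd z)))\<^sup>2"
      using Qk
    proof eventually_elim
      case (elim z)
      have "(dist (f (fst z)) (snd (snd z)))\<^sup>2 \<le> (1 + 1 / \<eta>) * (dist (f (fst z)) (fst (snd z)))\<^sup>2
          + (1 + \<eta>) * (dist (fst (snd z)) (snd (snd z)))\<^sup>2"
        \<comment> \<open>With weight \<open>1 / \<eta>\<close> the large factor falls on the
          distance inside a cell, which is at most \<eta>, and the true cost is multiplied only by
          \<open>1 + \<eta>\<close>.\<close>
        using dist_sq_le_weighted[of "1/\<eta>" "f (fst z)" "snd (snd z)" "fst (snd z)"] \<eta> by simp
      moreover have "(1 + 1 / \<eta>) * (dist (f (fst z)) (fst (snd z)))\<^sup>2 \<le> (1 + 1 / \<eta>) * \<eta>\<^sup>2"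
        using \<eta> k[OF elim] by (intro mult_left_mono power_mono) auto
      ultimately show ?case by linarith
    qed
  qed
  also have "\<dots> = (1 + 1 / \<eta>) * \<eta>\<^sup>2 + (1 + \<eta>) * c"
    using i2 by (simp add: c2 Q.prob_space)
  also have "\<dots> = c + (\<eta> * c + \<eta> * (\<eta> + 1))"
    using \<eta> by (simp add: field_simps power2_eq_square)
  also have "\<dots> \<le> c + \<eta> * (c + 2)"
    using \<eta> by (simp add: algebra_simps)
  also have "\<dots> \<le> (W2 \<mu> \<nu>)\<^sup>2 + e"
    using \<eta>(3) \<gamma>(2) by (simp add: c_def)
  finally show ?thesis
    using P1 P2' by (intro exI[of _ P]) (auto simp: P_def \<mu>_def)
qed

section \<open>Test functions\<close>

lemma frechet_derivative_zero_off_closed: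
  fixes g :: "'a::euclidean_space \<Rightarrow> real"
  assumes "closed K" and "\<And>x. x \<notin> K \<Longrightarrow> g x = 0" and "x \<notin> K"
  shows "frechet_derivative g (at x) = (\<lambda>_. 0)"
proof -
  have "((\<lambda>_. 0::real) has_derivative (\<lambda>_. 0)) (at x)" by simp
  \<comment> \<open>The complement of \<open>K\<close> is open, so \<open>g\<close> coincides with
    the zero function near \<open>x\<close>.\<close>
  then have "(g has_derivative (\<lambda>_. 0)) (at x)"
    by (rule has_derivative_transform_within_open[where s="- K"]) (use assms in auto)
  then show ?thesis by (rule frechet_derivative_at[symmetric])
qed

lemma bounded_continuous_zero_off_compact:
  fixes g :: "'a::euclidean_space \<Rightarrow> real"
  assumes "continuous_on UNIV g" and "compact K" and "\<And>x. x \<notin> K \<Longrightarrow> g x = 0"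
  shows "\<exists>B\<ge>0. \<forall>x. \<bar>g x\<bar> \<le> B"
proof -
  have "compact (g ` K)"
    using assms by (intro compact_continuous_image continuous_on_subset[OF assms(1)]) auto
  then have "bounded (g ` K)" by (rule compact_imp_bounded)
  then obtain B where B: "B > 0" "\<And>y. y \<in> g ` K \<Longrightarrow> norm y \<le> B"
    unfolding bounded_pos by blast
  have "\<bar>g x\<bar> \<le> B" for x
    using B assms(3)[of x] by (cases "x \<in> K") auto
  then show ?thesis using B by (intro exI[of _ B]) auto
qed

text \<open>\<open>Ck\<close> controls derivatives only along basis vectors; this assembles them
  into a gradient representing the whole derivative.\<close>

lemma frechet_derivative_gradient:
  fixes g :: "'a::euclidean_space \<Rightarrow> real"
  assumes "g differentiable (at x)"
  shows "frechet_derivative g (at x) h = (\<Sum>b\<in>Basis. frechet_derivative g (at x) b *\<^sub>R b) \<bullet> h"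
proof -
  interpret linear "frechet_derivative g (at x)"
    using assms by (rule linear_frechet_derivative)
  have "frechet_derivative g (at x) h = frechet_derivative g (at x) (\<Sum>b\<in>Basis. (h \<bullet> b) *\<^sub>R b)"
    by (simp add: euclidean_representation)
  also have "\<dots> = (\<Sum>b\<in>Basis. (h \<bullet> b) * frechet_derivative g (at x) b)"
    by (simp add: sum scale)
  finally show ?thesis
    by (simp add: inner_sum_left inner_commute[of h] mult.commute)
qed

text \<open>The partial derivatives are continuous and vanish off \<open>K\<close>, hence are
  bounded. Their bounds add up to a bound on the operator norm, and the mean value inequality
  applies. The lemma serves for the partial derivatives of a test function.\<close>

lemma lipschitz_C1_zero_off_compact:
  fixes g :: "'a::euclidean_space \<Rightarrow> real"
  assumes g: "Ck (Suc 0) g" and K: "compact K" and 0: "\<And>x. x \<notin> K \<Longrightarrow> g x = 0"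
  shows "\<exists>B\<ge>0. \<forall>x y. \<bar>g x - g y\<bar> \<le> B * dist x y"
proof -
  let ?D = "\<lambda>x. frechet_derivative g (at x)"
  have "\<exists>B\<ge>0. \<forall>x. \<bar>?D x b\<bar> \<le> B" if "b \<in> Basis" for b
    using g that frechet_derivative_zero_off_closed[OF compact_imp_closed[OF K], of g, OF 0]
    by (intro bounded_continuous_zero_off_compact[OF _ K]) auto
  then obtain B where B: "\<And>b x. b \<in> Basis \<Longrightarrow> \<bar>?D x b\<bar> \<le> B b" "\<And>b. b \<in> Basis \<Longrightarrow> B b \<ge> 0"
    by metis
  have diff: "g differentiable (at x)" for x
    using g by (auto simp: differentiable_on_def)
  have on: "onorm (?D x) \<le> sum B Basis" for x
  proof (rule onorm_le)
    fix h
    have "norm (?D x h) = \<bar>\<Sum>b\<in>Basis. ?D x b * (b \<bullet> h)\<bar>"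
      by (subst frechet_derivative_gradient[OF diff]) (simp add: inner_sum_left)
    also have "\<dots> \<le> (\<Sum>b\<in>Basis. \<bar>?D x b * (b \<bullet> h)\<bar>)" by (rule sum_abs)
    also have "\<dots> \<le> (\<Sum>b\<in>Basis. B b * norm h)"
    proof (rule sum_mono)
      fix b :: 'a assume b: "b \<in> Basis"
      have "\<bar>b \<bullet> h\<bar> \<le> norm h" using Basis_le_norm[OF b, of h] by (simp add: inner_commute)
      then show "\<bar>?D x b * (b \<bullet> h)\<bar> \<le> B b * norm h"
        unfolding abs_mult using B b by (intro mult_mono) auto
    qed
    finally show "norm (?D x h) \<le> sum B Basis * norm h" by (simp add: sum_distrib_right)
  qed
  have "norm (g x - g y) \<le> sum B Basis * norm (x - y)" for x y
    by (rule differentiable_bound[where S=UNIV and f'="?D"])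
      (use on diff in \<open>auto simp: frechet_derivative_works\<close>)
  moreover have "sum B Basis \<ge> 0" using B(2) by (rule sum_nonneg)
  ultimately show ?thesis by (intro exI[of _ "sum B Basis"]) (auto simp: dist_norm)
qed

lemma Cc_infinity_bounded:
  assumes "\<phi> \<in> Cc_infinity"
  shows "\<exists>B. \<forall>x. \<bar>\<phi> x\<bar> \<le> B" and "continuous_on UNIV \<phi>"
proof -
  have "Ck 0 \<phi>" and K: "compact (closure {x. \<phi> x \<noteq> 0})"
    using assms unfolding Cc_infinity_def by blast+
  then show "continuous_on UNIV \<phi>" by simp
  have "\<phi> x = 0" if "x \<notin> closure {x. \<phi> x \<noteq> 0}" for x
    using that closure_subset[of "{x. \<phi> x \<noteq> 0}"] by auto
  then have "\<exists>B\<ge>0. \<forall>x. \<bar>\<phi> x\<bar> \<le> B"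
    using \<open>continuous_on UNIV \<phi>\<close> by (rule bounded_continuous_zero_off_compact[OF _ K, rotated])
  then show "\<exists>B. \<forall>x. \<bar>\<phi> x\<bar> \<le> B" by blast
qed

text \<open>Here \<psi> is the gradient of \<phi>, \<open>S\<close> bounds its norm and
  \<open>L\<close> is a Lipschitz constant for it. The remainder estimate does not aim at the sharp
  factor 1/2.\<close>

lemma Cc_infinity_taylor:
  fixes \<phi> :: "'a::euclidean_space \<Rightarrow> real"
  assumes "\<phi> \<in> Cc_infinity"
  shows "\<exists>\<psi> S L. continuous_on UNIV \<psi> \<and> S \<ge> 0 \<and> L \<ge> 0 \<and> (\<forall>x. norm (\<psi> x) \<le> S) \<and>
           (\<forall>x y. \<bar>\<phi> y - \<phi> x - \<psi> x \<bullet> (y - x)\<bar> \<le> L * (dist x y)\<^sup>2)"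
proof -
  define K where "K = closure {x. \<phi> x \<noteq> 0}"
  have K: "compact K" and Ck: "Ck (Suc (Suc 0)) \<phi>"
    using assms unfolding Cc_infinity_def K_def by blast+
  have 0: "\<phi> x = 0" if "x \<notin> K" for x
    using that closure_subset[of "{x. \<phi> x \<noteq> 0}"] by (auto simp: K_def)
  let ?D = "\<lambda>x. frechet_derivative \<phi> (at x)"
  have D0: "?D x b = 0" if "x \<notin> K" for x b
    using frechet_derivative_zero_off_closed[OF compact_imp_closed[OF K], of \<phi>, OF 0 that] by simp
  have D1: "Ck (Suc 0) (\<lambda>x. ?D x b)" if "b \<in> Basis" for b
    using Ck that by (metis Ck.simps(2))
  have diff: "\<phi> differentiable (at x)" for x
    using Ck by (auto simp: differentiable_on_def)
  have Dc: "continuous_on UNIV (\<lambda>x. ?D x b)" if "b \<in> Basis" for b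
    using D1[OF that] by (auto intro: differentiable_imp_continuous_on)
  have "\<exists>B\<ge>0. \<forall>x. \<bar>?D x b\<bar> \<le> B" if "b \<in> Basis" for b
    using bounded_continuous_zero_off_compact[OF Dc[OF that] K] D0 by blast
  then obtain B where B: "\<And>b x. b \<in> Basis \<Longrightarrow> \<bar>?D x b\<bar> \<le> B b" "\<And>b. b \<in> Basis \<Longrightarrow> B b \<ge> 0"
    by metis
  have "\<exists>B\<ge>0. \<forall>x y. \<bar>?D x b - ?D y b\<bar> \<le> B * dist x y" if "b \<in> Basis" for b
    by (rule lipschitz_C1_zero_off_compact[OF D1[OF that] K D0])
  then obtain L where L: "\<And>b x y. b \<in> Basis \<Longrightarrow> \<bar>?D x b - ?D y b\<bar> \<le> L b * dist x y"
      "\<And>b. b \<in> Basis \<Longrightarrow> L b \<ge> 0"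
    by metis
  define \<psi> where "\<psi> x = (\<Sum>b\<in>Basis. ?D x b *\<^sub>R b)" for x
  have c: "continuous_on UNIV \<psi>"
    unfolding \<psi>_def using Dc by (intro continuous_intros) auto
  have S: "norm (\<psi> x) \<le> sum B Basis" for x
    unfolding \<psi>_def using B by (intro order_trans[OF norm_sum] sum_mono) auto
  have lip: "norm (\<psi> x - \<psi> y) \<le> sum L Basis * dist x y" for x y
  proof -
    have "\<psi> x - \<psi> y = (\<Sum>b\<in>Basis. (?D x b - ?D y b) *\<^sub>R b)"
      by (simp add: \<psi>_def sum_subtractf scaleR_diff_left)
    also have "norm \<dots> \<le> (\<Sum>b\<in>Basis. L b * dist x y)"
      using L by (intro order_trans[OF norm_sum] sum_mono) auto
    finally show ?thesis by (simp add: sum_distrib_right)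
  qed
  have L0: "sum L Basis \<ge> 0" using L(2) by (rule sum_nonneg)
  have D: "(\<phi> has_derivative (\<lambda>h. \<psi> x \<bullet> h)) (at x)" for x
  proof -
    have "?D x = (\<lambda>h. \<psi> x \<bullet> h)"
      unfolding \<psi>_def by (rule ext) (rule frechet_derivative_gradient[OF diff])
    then show ?thesis using diff[of x] unfolding frechet_derivative_works by simp
  qed
  \<comment> \<open>On the segment from \<open>x\<close> to \<open>y\<close> the derivative differs
    from that at \<open>x\<close> by at most the Lipschitz constant times \<open>dist x y\<close>;
    the mean value inequality contributes the second factor \<open>dist x y\<close>.\<close>
  have lin: "norm (\<phi> y - \<phi> x - \<psi> x \<bullet> (y - x)) \<le> norm (y - x) * (sum L Basis * dist x y)" for x y
  proof (rule differentiable_bound_linearization[where S="closed_segment x y" and f'="\<lambda>x h. \<psi> x \<bullet> h"])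
    fix z assume z: "z \<in> closed_segment x y"
    show "onorm ((\<lambda>h. \<psi> z \<bullet> h) - (\<lambda>h. \<psi> x \<bullet> h)) \<le> sum L Basis * dist x y"
    proof (rule onorm_le)
      fix h
      have "norm (((\<lambda>h. \<psi> z \<bullet> h) - (\<lambda>h. \<psi> x \<bullet> h)) h) = \<bar>(\<psi> z - \<psi> x) \<bullet> h\<bar>"
        by (simp add: inner_diff_left)
      also have "\<dots> \<le> norm (\<psi> z - \<psi> x) * norm h" by (rule Cauchy_Schwarz_ineq2)
      also have "\<dots> \<le> sum L Basis * dist x y * norm h"
      proof (rule mult_right_mono)
        have "dist z x \<le> dist x y"
          using segment_bound(1)[OF z] by (simp add: dist_norm norm_minus_commute)
        then show "norm (\<psi> z - \<psi> x) \<le> sum L Basis * dist x y"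
          using lip[of z x] L0 mult_left_mono by (meson order_trans)
      qed simp
      finally show "norm (((\<lambda>h. \<psi> z \<bullet> h) - (\<lambda>h. \<psi> x \<bullet> h)) h) \<le> sum L Basis * dist x y * norm h" .
    qed
  next
    fix t :: real assume "t \<in> {0..1}"
    then show "x + t *\<^sub>R (y - x) \<in> closed_segment x y"
      unfolding in_segment by (intro exI[of _ t]) (simp add: algebra_simps)
  next
    fix z show "((\<phi>) has_derivative (\<lambda>h. \<psi> z \<bullet> h)) (at z within closed_segment x y)"
      by (rule has_derivative_at_withinI[OF D])
  qed simp
  have "\<bar>\<phi> y - \<phi> x - \<psi> x \<bullet> (y - x)\<bar> \<le> sum L Basis * (dist x y)\<^sup>2" for x y
    using lin[where x=x and y=y]
    by (simp add: dist_norm norm_minus_commute[of x y] power2_eq_square mult.left_commute)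
  moreover have "sum B Basis \<ge> 0" using B(2) by (rule sum_nonneg)
  ultimately show ?thesis using c S L0 by blast
qed

section \<open>The metric extrapolation\<close>

text \<open>\<open>Z\<close> is coupled near-optimally to \<open>T X Y\<close>. Taking
  \<open>T\<close> to be the second projection gives the chain for a triangle inequality;
  \<open>x + t *\<^sub>R \<psi> y\<close> gives the competitor in the variational argument. The
  integrability of \<open>T\<close> is asked for every coupling because the one used is chosen
  inside the proof.\<close>

lemma near_optimal_triple:
  fixes \<rho> \<mu> \<nu> :: "'a::euclidean_space measure" and T :: "'a \<Rightarrow> 'a \<Rightarrow> 'a"
  assumes P2: "\<rho> \<in> P2" "\<mu> \<in> P2" "\<nu> \<in> P2" and e: "e > 0"
    and T[measurable]: "case_prod T \<in> borel_measurable (borel \<Otimes>\<^sub>M borel)"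
    and intT: "\<And>\<gamma>. \<gamma> \<in> couplings \<rho> \<mu> \<Longrightarrow> integrable \<gamma> (\<lambda>z. (norm (T (fst z) (snd z)))\<^sup>2)"
  obtains P :: "(('a \<times> 'a) \<times> 'a) measure" and X Y Z
  where "prob_space P" "X \<in> borel_measurable P" "Y \<in> borel_measurable P" "Z \<in> borel_measurable P"
    "distr P borel X = \<rho>" "distr P borel Y = \<mu>" "distr P borel Z = \<nu>"
    "distr P borel (\<lambda>z. T (X z) (Y z)) \<in> P2"
    "(\<integral>z. (dist (X z) (Y z))\<^sup>2 \<partial>P) \<le> (W2 \<rho> \<mu>)\<^sup>2 + e"
    "(\<integral>z. (dist (T (X z) (Y z)) (Z z))\<^sup>2 \<partial>P) \<le> (W2 (distr P borel (\<lambda>z. T (X z) (Y z))) \<nu>)\<^sup>2 + e"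
proof -
  obtain \<gamma> where \<gamma>: "\<gamma> \<in> couplings \<rho> \<mu>"
      "(\<integral>z. (dist (fst z) (snd z))\<^sup>2 \<partial>\<gamma>) \<le> (W2 \<rho> \<mu>)\<^sup>2 + e"
    using near_optimal_coupling[OF P2(1,2) e] by blast
  have [measurable_cong]: "sets \<gamma> = sets (borel \<Otimes>\<^sub>M borel)"
    and g1: "distr \<gamma> borel fst = \<rho>" and g2: "distr \<gamma> borel snd = \<mu>"
    using \<gamma>(1) by (auto simp: couplings_def)
  have pg: "prob_space \<gamma>"
    by (rule prob_space_distrD[of fst _ borel]) (use P2 in \<open>auto simp: g1 P2_def\<close>)
  have [measurable]: "(\<lambda>z. T (fst z) (snd z)) \<in> borel_measurable (borel \<Otimes>\<^sub>M borel)"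
    using T by (simp add: case_prod_beta')
  have mT: "(\<lambda>z. T (fst z) (snd z)) \<in> borel_measurable \<gamma>"
    by measurable
  obtain P where P[measurable_cong]: "sets P = sets (\<gamma> \<Otimes>\<^sub>M borel)"
    and P1: "distr P \<gamma> fst = \<gamma>" and P2': "distr P borel snd = \<nu>"
    and c: "(\<integral>z. (dist (T (fst (fst z)) (snd (fst z))) (snd z))\<^sup>2 \<partial>P)
        \<le> (W2 (distr \<gamma> borel (\<lambda>z. T (fst z) (snd z))) \<nu>)\<^sup>2 + e"
    using lift_near_optimal_coupling[OF pg mT intT[OF \<gamma>(1)] P2(3) e] by auto
  have d: "distr P borel (\<lambda>z. g (fst z)) = distr \<gamma> borel g"
    if "g \<in> borel_measurable \<gamma>" for g :: "'a \<times> 'a \<Rightarrow> 'a"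
    using that by (subst P1[symmetric]) (simp add: distr_distr comp_def)
  have dT: "distr P borel (\<lambda>z. T (fst (fst z)) (snd (fst z))) = distr \<gamma> borel (\<lambda>z. T (fst z) (snd z))"
    using d[OF mT] .
  have "distr \<gamma> borel (\<lambda>z. T (fst z) (snd z)) \<in> P2"
    by (rule P2_distrI[OF pg mT intT[OF \<gamma>(1)]])
  moreover have "(\<integral>z. (dist (fst (fst z)) (snd (fst z)))\<^sup>2 \<partial>P) = (\<integral>z. (dist (fst z) (snd z))\<^sup>2 \<partial>\<gamma>)"
    using integral_distr[of fst P \<gamma> "\<lambda>z. (dist (fst z) (snd z))\<^sup>2"] by (simp add: P1)
  moreover have "prob_space P"
    by (rule prob_space_distrD[of fst _ \<gamma>]) (use pg in \<open>auto simp: P1\<close>)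
  moreover have "distr P borel (\<lambda>z. fst (fst z)) = \<rho>" "distr P borel (\<lambda>z. snd (fst z)) = \<mu>"
    using d[of fst] d[of snd] g1 g2 by auto
  ultimately show ?thesis
    using c P2' \<gamma>(2) unfolding dT[symmetric]
    by (intro that[of P "\<lambda>z. fst (fst z)" "\<lambda>z. snd (fst z)" snd]) auto
qed

text \<open>The pointwise weighted inequality is integrated over a chain \<open>X\<close>,
  \<open>Y\<close>, \<open>Z\<close> whose consecutive pairs are both near-optimal, and the defect
  then tends to 0.\<close>

lemma W2_sq_le_weighted:
  fixes \<rho> \<mu> \<nu> :: "'a::euclidean_space measure"
  assumes P2: "\<rho> \<in> P2" "\<mu> \<in> P2" "\<nu> \<in> P2" and d: "d > 0"
  shows "(W2 \<rho> \<nu>)\<^sup>2 \<le> (1 + d) * (W2 \<rho> \<mu>)\<^sup>2 + (1 + 1 / d) * (W2 \<mu> \<nu>)\<^sup>2"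
proof (rule field_le_epsilon)
  fix e :: real assume e: "e > 0"
  \<comment> \<open>The two defects are multiplied by \<open>1 + d\<close> and
    \<open>1 + 1 / d\<close>, so the total loss is exactly \<open>e\<close>.\<close>
  define e' where "e' = e / (2 + d + 1 / d)"
  have e': "e' > 0" using e d by (auto simp: e'_def intro!: divide_pos_pos add_pos_pos)
  have intT: "integrable \<gamma> (\<lambda>z. (norm (snd z))\<^sup>2)" if "\<gamma> \<in> couplings \<rho> \<mu>" for \<gamma>
  proof -
    have [measurable_cong]: "sets \<gamma> = sets (borel \<Otimes>\<^sub>M borel)"
      using that by (simp add: couplings_def)
    show ?thesis using that P2 by (intro P2_distrD) (auto simp: couplings_def)
  qed
  obtain P :: "(('a \<times> 'a) \<times> 'a) measure" and X Y Z
  where P: "prob_space P" "X \<in> borel_measurable P" "Y \<in> borel_measurable P" "Z \<in> borel_measurable P"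
    "distr P borel X = \<rho>" "distr P borel Y = \<mu>" "distr P borel Z = \<nu>"
    "(\<integral>z. (dist (X z) (Y z))\<^sup>2 \<partial>P) \<le> (W2 \<rho> \<mu>)\<^sup>2 + e'"
    "(\<integral>z. (dist (Y z) (Z z))\<^sup>2 \<partial>P) \<le> (W2 (distr P borel Y) \<nu>)\<^sup>2 + e'"
    by ((rule near_optimal_triple[OF P2 e', of "\<lambda>x y. y"]), (simp add: case_prod_beta'),
        (rule intT), assumption, (rule that; assumption))
  note [measurable] = P(2-4)
  have sq: "integrable P (\<lambda>z. (norm (X z))\<^sup>2)" "integrable P (\<lambda>z. (norm (Y z))\<^sup>2)"
    "integrable P (\<lambda>z. (norm (Z z))\<^sup>2)"
    using P(5-7) P2 by (auto intro!: P2_distrD)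
  have i: "integrable P (\<lambda>z. (dist (X z) (Y z))\<^sup>2)" "integrable P (\<lambda>z. (dist (Y z) (Z z))\<^sup>2)"
    "integrable P (\<lambda>z. (dist (X z) (Z z))\<^sup>2)"
    using sq by (auto intro!: integrable_dist_sq)
  have "(W2 \<rho> \<nu>)\<^sup>2 \<le> (\<integral>z. (dist (X z) (Z z))\<^sup>2 \<partial>P)"
    using P i by (intro W2_sq_le) auto
  also have "\<dots> \<le> (\<integral>z. (1 + d) * (dist (X z) (Y z))\<^sup>2 + (1 + 1 / d) * (dist (Y z) (Z z))\<^sup>2 \<partial>P)"
    using i by (intro integral_mono dist_sq_le_weighted d) auto
  also have "\<dots> = (1 + d) * (\<integral>z. (dist (X z) (Y z))\<^sup>2 \<partial>P) + (1 + 1 / d) * (\<integral>z. (dist (Y z) (Z z))\<^sup>2 \<partial>P)"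
    using i by simp
  also have "\<dots> \<le> (1 + d) * ((W2 \<rho> \<mu>)\<^sup>2 + e') + (1 + 1 / d) * ((W2 \<mu> \<nu>)\<^sup>2 + e')"
    using P d by (intro add_mono mult_left_mono) auto
  also have "\<dots> = (1 + d) * (W2 \<rho> \<mu>)\<^sup>2 + (1 + 1 / d) * (W2 \<mu> \<nu>)\<^sup>2 + (2 + d + 1 / d) * e'"
    by (simp add: algebra_simps)
  also have "(2 + d + 1 / d) * e' = e"
  proof -
    have "2 + d + 1 / d > 0" using d by (intro add_pos_pos) auto
    then show ?thesis unfolding e'_def by simp
  qed
  finally show "(W2 \<rho> \<nu>)\<^sup>2 \<le> (1 + d) * (W2 \<rho> \<mu>)\<^sup>2 + (1 + 1 / d) * (W2 \<mu> \<nu>)\<^sup>2 + e" .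
qed

lemma W2_self:
  fixes \<mu> :: "'a::euclidean_space measure"
  assumes "\<mu> \<in> P2"
  shows "W2 \<mu> \<mu> = 0"
proof -
  have [measurable_cong]: "sets \<mu> = sets borel" using assms by (simp add: P2_def)
  have "distr \<mu> borel (\<lambda>x. x) = \<mu>" by (rule distr_id2) (simp add: \<open>sets \<mu> = sets borel\<close>)
  then have "(W2 \<mu> \<mu>)\<^sup>2 \<le> (\<integral>z. (dist z z)\<^sup>2 \<partial>\<mu>)"
    by (intro W2_sq_le) auto
  then show ?thesis by simp
qed

lemma W2_commute:
  fixes \<mu> \<nu> :: "'a::euclidean_space measure"
  shows "W2 \<mu> \<nu> = W2 \<nu> \<mu>"
proof -
  have le: "(INF \<gamma>\<in>couplings \<mu> \<nu>. \<integral>\<^sup>+ z. ennreal ((dist (fst z) (snd z))\<^sup>2) \<partial>\<gamma>)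
      \<le> (INF \<gamma>\<in>couplings \<nu> \<mu>. \<integral>\<^sup>+ z. ennreal ((dist (fst z) (snd z))\<^sup>2) \<partial>\<gamma>)"
    for \<mu> \<nu> :: "'a measure"
  proof (rule INF_mono)
    fix \<gamma> :: "('a \<times> 'a) measure" assume \<gamma>: "\<gamma> \<in> couplings \<nu> \<mu>"
    then have [measurable_cong]: "sets \<gamma> = sets (borel \<Otimes>\<^sub>M borel)"
      by (simp add: couplings_def)
    let ?s = "\<lambda>z::'a \<times> 'a. (snd z, fst z)"
    have "distr \<gamma> (borel \<Otimes>\<^sub>M borel) ?s \<in> couplings \<mu> \<nu>"
      using \<gamma> by (auto simp: couplings_def distr_distr comp_def)
    moreover have "(\<integral>\<^sup>+ z. ennreal ((dist (fst z) (snd z))\<^sup>2) \<partial>distr \<gamma> (borel \<Otimes>\<^sub>M borel) ?s)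
        \<le> (\<integral>\<^sup>+ z. ennreal ((dist (fst z) (snd z))\<^sup>2) \<partial>\<gamma>)"
      by (subst nn_integral_distr) (auto simp: dist_commute)
    ultimately show "\<exists>\<gamma>'\<in>couplings \<mu> \<nu>. (\<integral>\<^sup>+ z. ennreal ((dist (fst z) (snd z))\<^sup>2) \<partial>\<gamma>')
        \<le> (\<integral>\<^sup>+ z. ennreal ((dist (fst z) (snd z))\<^sup>2) \<partial>\<gamma>)" by blast
  qed
  show ?thesis unfolding W2_def by (intro arg_cong[where f=sqrt] arg_cong[where f=enn2real] antisym le)
qed

section \<open>Consequences of minimality\<close>

lemma is_metric_extrapolationD:
  assumes "is_metric_extrapolation \<alpha> \<mu>\<^sub>0 \<mu>\<^sub>1 \<rho>"
  shows "\<rho> \<in> P2"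
    and "\<sigma> \<in> P2 \<Longrightarrow> \<alpha> * (W2 \<rho> \<mu>\<^sub>1)\<^sup>2 - (\<alpha> - 1) * (W2 \<rho> \<mu>\<^sub>0)\<^sup>2
            \<le> \<alpha> * (W2 \<sigma> \<mu>\<^sub>1)\<^sup>2 - (\<alpha> - 1) * (W2 \<sigma> \<mu>\<^sub>0)\<^sup>2"
  using assms by (auto simp: is_metric_extrapolation_def is_arg_min_linorder)

text \<open>The competitor \<open>\<mu>\<^sub>1\<close> gives
  \<open>\<alpha> * a \<le> \<beta> * b - \<beta> * w\<close>, and the weighted triangle inequality
  bounds \<open>\<beta> * b\<close> by \<open>(\<beta> + 1 / 2) * a\<close> plus a multiple of
  \<open>w\<close>. Since \<alpha> is \<beta> + 1, half of \<open>a\<close> survives on the left and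
  can be solved for.\<close>

lemma metric_extrapolation_W2_bounds:
  fixes \<mu>\<^sub>0 \<mu>\<^sub>1 \<rho> :: "'a::euclidean_space measure"
  assumes "\<alpha> > 1" and \<mu>: "\<mu>\<^sub>0 \<in> P2" "\<mu>\<^sub>1 \<in> P2"
    and \<rho>: "is_metric_extrapolation \<alpha> \<mu>\<^sub>0 \<mu>\<^sub>1 \<rho>" and \<beta>: "\<beta> = \<alpha> - 1"
  shows "(W2 \<rho> \<mu>\<^sub>1)\<^sup>2 \<le> 4 * \<beta>\<^sup>2 * (W2 \<mu>\<^sub>0 \<mu>\<^sub>1)\<^sup>2"
    and "\<beta> * (W2 \<rho> \<mu>\<^sub>0)\<^sup>2 \<le> \<beta> * (2 * \<beta> + 1)\<^sup>2 * (W2 \<mu>\<^sub>0 \<mu>\<^sub>1)\<^sup>2"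
proof -
  define a b w where "a = (W2 \<rho> \<mu>\<^sub>1)\<^sup>2" and "b = (W2 \<rho> \<mu>\<^sub>0)\<^sup>2" and "w = (W2 \<mu>\<^sub>0 \<mu>\<^sub>1)\<^sup>2"
  have b0: "\<beta> > 0" using assms by simp
  have 1: "\<alpha> * a \<le> \<beta> * b - \<beta> * w"
    using is_metric_extrapolationD(2)[OF \<rho> \<mu>(2)] W2_self[OF \<mu>(2)] W2_commute[of \<mu>\<^sub>1 \<mu>\<^sub>0]
    by (simp add: a_def b_def w_def \<beta>)
  \<comment> \<open>The weight \<open>1 / (2 * \<beta>)\<close> makes Young's inequality an equality
    in the extremal case \<open>a = 4 * \<beta>\<^sup>2 * w\<close>, so nothing is lost against the
    unsquared triangle inequality.\<close>
  have "b \<le> (1 + 1 / (2 * \<beta>)) * a + (1 + 1 / (1 / (2 * \<beta>))) * w"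
    unfolding a_def b_def w_def W2_commute[of \<mu>\<^sub>0 \<mu>\<^sub>1]
    using b0 by (intro W2_sq_le_weighted is_metric_extrapolationD(1)[OF \<rho>] \<mu>) auto
  then have "\<beta> * b \<le> \<beta> * ((1 + 1 / (2 * \<beta>)) * a + (1 + 1 / (1 / (2 * \<beta>))) * w)"
    using b0 by (intro mult_left_mono) auto
  also have "\<dots> = (\<beta> + 1 / 2) * a + (\<beta> + 2 * \<beta>\<^sup>2) * w"
    using b0 by (simp add: field_simps power2_eq_square)
  finally have 2: "\<beta> * b \<le> (\<beta> + 1 / 2) * a + (\<beta> + 2 * \<beta>\<^sup>2) * w" .
  have 3: "a \<le> 4 * \<beta>\<^sup>2 * w"
    using 1 2 unfolding \<beta> by (simp add: algebra_simps)
  have "(\<beta> + 1 / 2) * a \<le> (\<beta> + 1 / 2) * (4 * \<beta>\<^sup>2 * w)"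
    using 3 b0 by (intro mult_left_mono) auto
  with 2 have "\<beta> * b \<le> \<beta> * (2 * \<beta> + 1)\<^sup>2 * w"
    by (simp add: algebra_simps power2_eq_square)
  with 3 show "(W2 \<rho> \<mu>\<^sub>1)\<^sup>2 \<le> 4 * \<beta>\<^sup>2 * (W2 \<mu>\<^sub>0 \<mu>\<^sub>1)\<^sup>2"
    and "\<beta> * (W2 \<rho> \<mu>\<^sub>0)\<^sup>2 \<le> \<beta> * (2 * \<beta> + 1)\<^sup>2 * (W2 \<mu>\<^sub>0 \<mu>\<^sub>1)\<^sup>2"
    by (simp_all add: a_def b_def w_def)
qed

text \<open>Moving \<open>x\<close> by \<open>t *\<^sub>R \<psi> y\<close> changes the cost
  difference, to first order in \<open>t\<close>, by \<open>2 * t\<close> times the inner product of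
  \<open>\<psi> y\<close> with x - \<alpha> y + \<beta> z. This is also the linear Taylor part at
  \<open>y\<close> of the test expression on the right. The terms with \<open>L\<close> are Taylor
  remainders; the quadratic terms in \<open>t\<close> leave only one copy of
  \<open>t\<^sup>2 * S\<^sup>2\<close> since \<alpha> - \<beta> = 1.\<close>

lemma first_variation_pointwise:
  fixes \<phi> :: "'a::euclidean_space \<Rightarrow> real"
  assumes taylor: "\<And>x y. \<bar>\<phi> y - \<phi> x - \<psi> x \<bullet> (y - x)\<bar> \<le> L * (dist x y)\<^sup>2"
    and S: "norm (\<psi> y) \<le> S" and t: "t > 0" and \<beta>: "\<beta> = \<alpha> - 1" "\<beta> > 0"
  shows "\<alpha> * ((dist (x + t *\<^sub>R \<psi> y) y)\<^sup>2 - (dist x y)\<^sup>2)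
      - \<beta> * ((dist (x + t *\<^sub>R \<psi> y) z)\<^sup>2 - (dist x z)\<^sup>2)
      - t\<^sup>2 * S\<^sup>2 - 2 * t * L * (dist x y)\<^sup>2 - 2 * t * \<beta> * L * (dist y z)\<^sup>2
    \<le> 2 * t * (\<phi> x - \<alpha> * \<phi> y + \<beta> * \<phi> z)"
proof -
  have sq: "(dist (x + t *\<^sub>R \<psi> y) u)\<^sup>2 - (dist x u)\<^sup>2 = 2 * t * (\<psi> y \<bullet> (x - u)) + t\<^sup>2 * (norm (\<psi> y))\<^sup>2" for u
    unfolding dist_norm power2_norm_eq_inner
    by (simp add: algebra_simps inner_commute power2_eq_square)
  \<comment> \<open>Both sides pair \<open>\<psi> y\<close> with x - \<alpha> y + \<beta> z: the
    left groups it for the Taylor expansion at \<open>y\<close>, the right for the variation of the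
    two costs.\<close>
  have "\<psi> y \<bullet> (x - y) + \<beta> * (\<psi> y \<bullet> (z - y)) = \<alpha> * (\<psi> y \<bullet> (x - y)) - \<beta> * (\<psi> y \<bullet> (x - z))"
    by (simp add: \<beta> algebra_simps)
  moreover have "\<psi> y \<bullet> (x - y) - L * (dist x y)\<^sup>2 \<le> \<phi> x - \<phi> y"
    using taylor[of x y] by (simp add: dist_commute)
  moreover have "\<beta> * (\<psi> y \<bullet> (z - y) - L * (dist y z)\<^sup>2) \<le> \<beta> * (\<phi> z - \<phi> y)"
    using taylor[of z y] \<beta> by (intro mult_left_mono) auto
  moreover have "\<phi> x - \<alpha> * \<phi> y + \<beta> * \<phi> z = (\<phi> x - \<phi> y) + \<beta> * (\<phi> z - \<phi> y)"
    by (simp add: \<beta> algebra_simps)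
  ultimately have "\<alpha> * (\<psi> y \<bullet> (x - y)) - \<beta> * (\<psi> y \<bullet> (x - z)) - L * (dist x y)\<^sup>2 - \<beta> * (L * (dist y z)\<^sup>2)
      \<le> \<phi> x - \<alpha> * \<phi> y + \<beta> * \<phi> z"
    by (simp add: right_diff_distrib)
  then have "2 * t * (\<alpha> * (\<psi> y \<bullet> (x - y)) - \<beta> * (\<psi> y \<bullet> (x - z)) - L * (dist x y)\<^sup>2 - \<beta> * (L * (dist y z)\<^sup>2))
      \<le> 2 * t * (\<phi> x - \<alpha> * \<phi> y + \<beta> * \<phi> z)"
    using t by (intro mult_left_mono) auto
  moreover have "t\<^sup>2 * (norm (\<psi> y))\<^sup>2 \<le> t\<^sup>2 * S\<^sup>2"
    using S by (intro mult_left_mono power_mono) auto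
  moreover have "\<alpha> * (t\<^sup>2 * (norm (\<psi> y))\<^sup>2) = t\<^sup>2 * (norm (\<psi> y))\<^sup>2 + \<beta> * (t\<^sup>2 * (norm (\<psi> y))\<^sup>2)"
    by (simp add: \<beta> algebra_simps)
  ultimately show ?thesis
    unfolding sq by (simp add: algebra_simps)
qed

text \<open>The test function enters only through its bound and Taylor data, so the lemma also
  applies to its negative. The constant involves just \<alpha>, \<beta> and \<open>L\<close>, hence
  is uniform in the measures.\<close>

lemma metric_extrapolation_one_sided:
  fixes \<mu>\<^sub>0 \<mu>\<^sub>1 \<rho> :: "'a::euclidean_space measure" and \<phi> :: "'a \<Rightarrow> real"
  assumes \<alpha>: "\<alpha> > 1" and \<beta>: "\<beta> = \<alpha> - 1"
    and \<mu>: "\<mu>\<^sub>0 \<in> P2" "\<mu>\<^sub>1 \<in> P2"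
    and \<rho>: "is_metric_extrapolation \<alpha> \<mu>\<^sub>0 \<mu>\<^sub>1 \<rho>"
    and \<phi>: "continuous_on UNIV \<phi>" "\<And>x. \<bar>\<phi> x\<bar> \<le> B"
    and \<psi>: "continuous_on UNIV \<psi>" "\<And>x. norm (\<psi> x) \<le> S"
    and L: "L \<ge> 0"
    and taylor: "\<And>x y. \<bar>\<phi> y - \<phi> x - \<psi> x \<bullet> (y - x)\<bar> \<le> L * (dist x y)\<^sup>2"
  shows "- (L * ((1 + 2 * \<beta> + 8 * \<alpha>) * (4 * \<beta>\<^sup>2) + 4 * (\<beta> * (2 * \<beta> + 1)\<^sup>2))) * (W2 \<mu>\<^sub>0 \<mu>\<^sub>1)\<^sup>2
    \<le> (\<integral>x. \<phi> x \<partial>\<rho>) - \<alpha> * (\<integral>x. \<phi> x \<partial>\<mu>\<^sub>1) + \<beta> * (\<integral>x. \<phi> x \<partial>\<mu>\<^sub>0)"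
proof -
  define w D where "w = (W2 \<mu>\<^sub>0 \<mu>\<^sub>1)\<^sup>2"
    and "D = (\<integral>x. \<phi> x \<partial>\<rho>) - \<alpha> * (\<integral>x. \<phi> x \<partial>\<mu>\<^sub>1) + \<beta> * (\<integral>x. \<phi> x \<partial>\<mu>\<^sub>0)"
  define C where "C = L * ((1 + 2 * \<beta> + 8 * \<alpha>) * (4 * \<beta>\<^sup>2) + 4 * (\<beta> * (2 * \<beta> + 1)\<^sup>2))"
  \<comment> \<open>\<open>K\<close> collects every error of order \<open>t\<close>: the first
    summand comes from the coupling defects and the quadratic term of the variation, the second from
    the Taylor remainders.\<close>
  define K where "K = (\<alpha> + \<beta> + S\<^sup>2) / 2
      + L * ((1 + 2 * \<beta> + 8 * \<alpha>) + (8 * \<alpha> + 4 * \<beta>) * S\<^sup>2 + 4 * \<beta>)"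
  have \<beta>0: "\<beta> > 0" using \<alpha> \<beta> by simp
  have \<rho>P: "\<rho> \<in> P2" by (rule is_metric_extrapolationD(1)[OF \<rho>])
  have [measurable]: "\<phi> \<in> borel_measurable borel" "\<psi> \<in> borel_measurable borel"
    using \<phi>(1) \<psi>(1) by (auto intro: borel_measurable_continuous_onI)
  have a: "(W2 \<rho> \<mu>\<^sub>1)\<^sup>2 \<le> 4 * \<beta>\<^sup>2 * w"
    and b: "\<beta> * (W2 \<rho> \<mu>\<^sub>0)\<^sup>2 \<le> \<beta> * (2 * \<beta> + 1)\<^sup>2 * w"
    using metric_extrapolation_W2_bounds[OF \<alpha> \<mu> \<rho> \<beta>] by (auto simp: w_def)
  have K0: "K \<ge> 0" unfolding K_def using \<alpha> \<beta>0 L by (intro add_nonneg_nonneg mult_nonneg_nonneg) auto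
  \<comment> \<open>\<open>t\<close> is the size of the perturbation; all couplings are taken \<open>t\<^sup>2\<close>-optimal, so that the
    coupling defect stays negligible after dividing the first variation by \<open>t\<close>.\<close>
  have main: "- C * w - K * t \<le> D" if t: "0 < t" "t \<le> 1" for t :: real
  proof -
    have intT: "integrable \<gamma> (\<lambda>z. (norm (fst z + t *\<^sub>R \<psi> (snd z)))\<^sup>2)" if "\<gamma> \<in> couplings \<rho> \<mu>\<^sub>1" for \<gamma>
    proof -
      have [measurable_cong]: "sets \<gamma> = sets (borel \<Otimes>\<^sub>M borel)"
        using that by (simp add: couplings_def)
      have "prob_space \<gamma>"
        by (rule prob_space_distrD[of fst _ borel]) (use \<rho>P that in \<open>auto simp: couplings_def P2_def\<close>)
      then interpret prob_space \<gamma> .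
      have "integrable \<gamma> (\<lambda>z. (norm (- (t *\<^sub>R \<psi> (snd z))))\<^sup>2)"
        using \<psi>(2) t by (intro integrable_const_bound[of _ "(t * S)\<^sup>2"])
          (auto simp: power_mult_distrib intro!: mult_left_mono power_mono)
      moreover have "integrable \<gamma> (\<lambda>z. (norm (fst z))\<^sup>2)"
        using that \<rho>P by (intro P2_distrD) (auto simp: couplings_def)
      ultimately have "integrable \<gamma> (\<lambda>z. (dist (fst z) (- (t *\<^sub>R \<psi> (snd z))))\<^sup>2)"
        by (intro integrable_dist_sq) auto
      then show ?thesis by (simp add: dist_norm)
    qed
    have t2: "t\<^sup>2 > 0" using t by simp
    obtain P :: "(('a \<times> 'a) \<times> 'a) measure" and X Y Z
    where P: "prob_space P" "X \<in> borel_measurable P" "Y \<in> borel_measurable P" "Z \<in> borel_measurable P"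
      "distr P borel X = \<rho>" "distr P borel Y = \<mu>\<^sub>1" "distr P borel Z = \<mu>\<^sub>0"
      "distr P borel (\<lambda>z. X z + t *\<^sub>R \<psi> (Y z)) \<in> P2"
      "(\<integral>z. (dist (X z) (Y z))\<^sup>2 \<partial>P) \<le> (W2 \<rho> \<mu>\<^sub>1)\<^sup>2 + t\<^sup>2"
      "(\<integral>z. (dist (X z + t *\<^sub>R \<psi> (Y z)) (Z z))\<^sup>2 \<partial>P)
        \<le> (W2 (distr P borel (\<lambda>z. X z + t *\<^sub>R \<psi> (Y z))) \<mu>\<^sub>0)\<^sup>2 + t\<^sup>2"
      by ((rule near_optimal_triple[OF \<rho>P \<mu>(2) \<mu>(1) t2, of "\<lambda>x y. x + t *\<^sub>R \<psi> y"]),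
          measurable, (rule intT), assumption, (rule that; assumption))
    note [measurable] = P(2-4)
    interpret prob_space P by fact
    define T where "T z = X z + t *\<^sub>R \<psi> (Y z)" for z
    define \<sigma> where "\<sigma> = distr P borel T"
    have [measurable]: "T \<in> borel_measurable P" unfolding T_def by measurable
    have \<sigma>: "\<sigma> \<in> P2" using P(8) by (simp add: \<sigma>_def T_def[abs_def])
    have sq: "integrable P (\<lambda>z. (norm (X z))\<^sup>2)" "integrable P (\<lambda>z. (norm (Y z))\<^sup>2)"
      "integrable P (\<lambda>z. (norm (Z z))\<^sup>2)" "integrable P (\<lambda>z. (norm (T z))\<^sup>2)"
      using P(5-7) \<mu> \<rho>P \<sigma> by (auto intro!: P2_distrD simp: \<sigma>_def)
    have i[simp]: "integrable P (\<lambda>z. (dist (X z) (Y z))\<^sup>2)" "integrable P (\<lambda>z. (dist (Y z) (Z z))\<^sup>2)"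
      "integrable P (\<lambda>z. (dist (X z) (Z z))\<^sup>2)" "integrable P (\<lambda>z. (dist (T z) (Y z))\<^sup>2)"
      "integrable P (\<lambda>z. (dist (T z) (Z z))\<^sup>2)"
      using sq by (auto intro!: integrable_dist_sq)
    \<comment> \<open>The combination \<open>\<alpha> * (F - A) - \<beta> * (G - B0)\<close> has to
      be bounded below. Hence \<open>F\<close> and \<open>B0\<close> may come from any admissible
      coupling, whereas \<open>A\<close> and \<open>G\<close> must be near-optimal; this is why
      \<open>Z\<close> is coupled to the perturbed point and not to \<open>X\<close>.\<close>
    define A G B0 B1 F where "A = (\<integral>z. (dist (X z) (Y z))\<^sup>2 \<partial>P)"
      and "G = (\<integral>z. (dist (T z) (Z z))\<^sup>2 \<partial>P)"
      and "B0 = (\<integral>z. (dist (X z) (Z z))\<^sup>2 \<partial>P)"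
      and "B1 = (\<integral>z. (dist (Y z) (Z z))\<^sup>2 \<partial>P)"
      and "F = (\<integral>z. (dist (T z) (Y z))\<^sup>2 \<partial>P)"
    note defs = A_def G_def B0_def B1_def F_def
    have XT: "(dist (X z) (T z))\<^sup>2 \<le> t\<^sup>2 * S\<^sup>2" for z
      using \<psi>(2)[of "Y z"] t
      by (simp add: T_def dist_norm power_mult_distrib mult_left_mono power_mono)
    have A: "A \<le> 4 * \<beta>\<^sup>2 * w + t\<^sup>2" "A \<le> (W2 \<rho> \<mu>\<^sub>1)\<^sup>2 + t\<^sup>2"
      using P(9) a by (auto simp: A_def)
    have G: "G \<le> (W2 \<sigma> \<mu>\<^sub>0)\<^sup>2 + t\<^sup>2"
      using P(10) by (simp add: G_def \<sigma>_def T_def[abs_def])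
    have F: "(W2 \<sigma> \<mu>\<^sub>1)\<^sup>2 \<le> F"
      unfolding F_def using P(6) by (intro W2_sq_le) (auto simp: \<sigma>_def)
    have B0: "(W2 \<rho> \<mu>\<^sub>0)\<^sup>2 \<le> B0"
      unfolding B0_def using P(5,7) by (intro W2_sq_le) auto
    have "F \<le> (\<integral>z. 2 * (t\<^sup>2 * S\<^sup>2) + 2 * (dist (X z) (Y z))\<^sup>2 \<partial>P)"
      unfolding F_def
    proof (rule integral_mono)
      show "(dist (T z) (Y z))\<^sup>2 \<le> 2 * (t\<^sup>2 * S\<^sup>2) + 2 * (dist (X z) (Y z))\<^sup>2" for z
        using dist_sq_le_twice[of "T z" "Y z" "X z"] XT[of z] by (simp add: dist_commute)
    qed auto
    then have F': "F \<le> 2 * (t\<^sup>2 * S\<^sup>2) + 2 * A"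
      by (simp add: A_def prob_space)
    \<comment> \<open>The path from \<open>Y\<close> to \<open>Z\<close> runs through
      \<open>X\<close> and \<open>T\<close>, because the good control of \<open>Z\<close> is
      relative to \<open>T\<close>.\<close>
    have "B1 \<le> (\<integral>z. 2 * (dist (X z) (Y z))\<^sup>2 + (4 * (t\<^sup>2 * S\<^sup>2) + 4 * (dist (T z) (Z z))\<^sup>2) \<partial>P)"
      unfolding B1_def
    proof (rule integral_mono)
      show "(dist (Y z) (Z z))\<^sup>2
          \<le> 2 * (dist (X z) (Y z))\<^sup>2 + (4 * (t\<^sup>2 * S\<^sup>2) + 4 * (dist (T z) (Z z))\<^sup>2)" for z
        using dist_sq_le_twice[of "Y z" "Z z" "X z"] dist_sq_le_twice[of "X z" "Z z" "T z"] XT[of z]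
        by (simp add: dist_commute)
    qed auto
    then have B1: "B1 \<le> 2 * A + 4 * (t\<^sup>2 * S\<^sup>2) + 4 * G"
      by (simp add: defs prob_space)
    have min: "\<alpha> * (W2 \<rho> \<mu>\<^sub>1)\<^sup>2 - \<beta> * (W2 \<rho> \<mu>\<^sub>0)\<^sup>2 \<le> \<alpha> * (W2 \<sigma> \<mu>\<^sub>1)\<^sup>2 - \<beta> * (W2 \<sigma> \<mu>\<^sub>0)\<^sup>2"
      using is_metric_extrapolationD(2)[OF \<rho> \<sigma>] \<beta> by simp
    have s: "\<alpha> * (W2 \<sigma> \<mu>\<^sub>1)\<^sup>2 \<le> \<alpha> * F" "\<alpha> * A \<le> \<alpha> * ((W2 \<rho> \<mu>\<^sub>1)\<^sup>2 + t\<^sup>2)"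
      "\<beta> * G \<le> \<beta> * ((W2 \<sigma> \<mu>\<^sub>0)\<^sup>2 + t\<^sup>2)" "\<beta> * (W2 \<rho> \<mu>\<^sub>0)\<^sup>2 \<le> \<beta> * B0"
      "0 \<le> \<alpha> * (W2 \<rho> \<mu>\<^sub>1)\<^sup>2" "\<alpha> * F \<le> \<alpha> * (2 * (t\<^sup>2 * S\<^sup>2) + 2 * A)"
      "\<beta> * B1 \<le> \<beta> * (2 * A + 4 * (t\<^sup>2 * S\<^sup>2) + 4 * G)"
      using \<alpha> \<beta>0 by (intro mult_left_mono mult_nonneg_nonneg F A(2) G B0 F' B1; simp)+
    \<comment> \<open>Minimality is used here to control \<open>G\<close>: it bounds the cost from
      \<sigma> to \<open>\<mu>\<^sub>0\<close> by \<open>\<alpha> * F\<close> plus the cost from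
      \<rho> to \<open>\<mu>\<^sub>0\<close>, which \<open>b\<close> estimates by
      \<open>w\<close>.\<close>
    have "\<beta> * B1 \<le> 2 * \<beta> * A + 4 * \<beta> * (t\<^sup>2 * S\<^sup>2) + 4 * (\<alpha> * (2 * (t\<^sup>2 * S\<^sup>2) + 2 * A)
        + \<beta> * (2 * \<beta> + 1)\<^sup>2 * w + \<beta> * t\<^sup>2)"
      using s min b by (simp add: distrib_left)
    then have "A + \<beta> * B1 \<le> (1 + 2 * \<beta> + 8 * \<alpha>) * A + (8 * \<alpha> + 4 * \<beta>) * (t\<^sup>2 * S\<^sup>2)
        + 4 * (\<beta> * (2 * \<beta> + 1)\<^sup>2 * w) + 4 * \<beta> * t\<^sup>2"
      by (simp add: algebra_simps)
    moreover have "(1 + 2 * \<beta> + 8 * \<alpha>) * A \<le> (1 + 2 * \<beta> + 8 * \<alpha>) * (4 * \<beta>\<^sup>2 * w + t\<^sup>2)"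
      using A \<alpha> \<beta>0 by (intro mult_left_mono) auto
    ultimately have "A + \<beta> * B1 \<le> (1 + 2 * \<beta> + 8 * \<alpha>) * (4 * \<beta>\<^sup>2 * w + t\<^sup>2)
        + (8 * \<alpha> + 4 * \<beta>) * (t\<^sup>2 * S\<^sup>2) + 4 * (\<beta> * (2 * \<beta> + 1)\<^sup>2 * w) + 4 * \<beta> * t\<^sup>2"
      by linarith
    then have "L * (A + \<beta> * B1) \<le> L * ((1 + 2 * \<beta> + 8 * \<alpha>) * (4 * \<beta>\<^sup>2 * w + t\<^sup>2)
        + (8 * \<alpha> + 4 * \<beta>) * (t\<^sup>2 * S\<^sup>2) + 4 * (\<beta> * (2 * \<beta> + 1)\<^sup>2 * w) + 4 * \<beta> * t\<^sup>2)"
      using L by (rule mult_left_mono)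
    also have "\<dots> = C * w + (K - (\<alpha> + \<beta> + S\<^sup>2) / 2) * t\<^sup>2"
      by (simp add: C_def K_def algebra_simps)
    also have "\<dots> \<le> C * w + (K - (\<alpha> + \<beta> + S\<^sup>2) / 2) * t"
    proof -
      have "K - (\<alpha> + \<beta> + S\<^sup>2) / 2 \<ge> 0"
        unfolding K_def using \<alpha> \<beta>0 L by simp
      moreover have "t\<^sup>2 \<le> t" using t by (simp add: power2_eq_square mult_left_le)
      ultimately show ?thesis by (simp add: mult_left_mono)
    qed
    finally have LB: "L * (A + \<beta> * B1) \<le> C * w + (K - (\<alpha> + \<beta> + S\<^sup>2) / 2) * t" .
    have ip: "integrable P (\<lambda>z. \<phi> (X z))" "integrable P (\<lambda>z. \<phi> (Y z))" "integrable P (\<lambda>z. \<phi> (Z z))"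
      using \<phi>(2) by (auto intro!: integrable_const_bound[of _ B])
    have "D = (\<integral>z. \<phi> (X z) \<partial>P) - \<alpha> * (\<integral>z. \<phi> (Y z) \<partial>P) + \<beta> * (\<integral>z. \<phi> (Z z) \<partial>P)"
      unfolding D_def P(5-7)[symmetric] by (simp add: integral_distr)
    then have D: "D = (\<integral>z. \<phi> (X z) - \<alpha> * \<phi> (Y z) + \<beta> * \<phi> (Z z) \<partial>P)"
      using ip by simp
    have "\<alpha> * (F - A) - \<beta> * (G - B0) - t\<^sup>2 * S\<^sup>2 - 2 * t * L * A - 2 * t * \<beta> * L * B1
      = (\<integral>z. \<alpha> * ((dist (T z) (Y z))\<^sup>2 - (dist (X z) (Y z))\<^sup>2)
        - \<beta> * ((dist (T z) (Z z))\<^sup>2 - (dist (X z) (Z z))\<^sup>2)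
        - t\<^sup>2 * S\<^sup>2 - 2 * t * L * (dist (X z) (Y z))\<^sup>2 - 2 * t * \<beta> * L * (dist (Y z) (Z z))\<^sup>2 \<partial>P)"
      unfolding defs by (simp add: prob_space)
    also have "\<dots> \<le> (\<integral>z. 2 * t * (\<phi> (X z) - \<alpha> * \<phi> (Y z) + \<beta> * \<phi> (Z z)) \<partial>P)"
      unfolding T_def
      using ip i(4,5)[unfolded T_def]
      by (intro integral_mono first_variation_pointwise taylor \<psi>(2) t \<beta> \<beta>0) auto
    also have "\<dots> = 2 * t * D" unfolding D by simp
    finally have "\<alpha> * (F - A) - \<beta> * (G - B0) - t\<^sup>2 * S\<^sup>2 - 2 * t * L * A - 2 * t * \<beta> * L * B1 \<le> 2 * t * D" .
    \<comment> \<open>Minimality of \<rho> against \<sigma>, transferred to the triple: the defect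
      \<open>t\<^sup>2\<close> is paid once with factor \<alpha> for \<open>A\<close> and once with
      factor \<beta> for \<open>G\<close>.\<close>
    moreover have "- (\<alpha> + \<beta>) * t\<^sup>2 \<le> \<alpha> * (F - A) - \<beta> * (G - B0)"
      using s(1-4) min by (simp add: algebra_simps)
    ultimately have "t * (- ((\<alpha> + \<beta> + S\<^sup>2) * t) - 2 * (L * (A + \<beta> * B1))) \<le> t * (2 * D)"
      by (simp add: algebra_simps power2_eq_square)
    then have "- ((\<alpha> + \<beta> + S\<^sup>2) * t) - 2 * (L * (A + \<beta> * B1)) \<le> 2 * D"
      using t by simp
    with LB show ?thesis by (simp add: algebra_simps add_divide_distrib)
  qed
  have "- C * w \<le> D"
  proof (rule field_le_epsilon)
    fix e :: real assume e: "e > 0"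
    \<comment> \<open>The denominator \<open>K + 1\<close> is positive because \<open>K\<close> is
      nonnegative, and it gives \<open>K * t \<le> e\<close>.\<close>
    define t where "t = min 1 (e / (K + 1))"
    have t: "0 < t" "t \<le> 1" using e K0 by (auto simp: t_def)
    have "K * t \<le> (K + 1) * (e / (K + 1))"
      using K0 e by (intro mult_mono) (auto simp: t_def)
    also have "\<dots> = e" using K0 by simp
    finally show "- C * w \<le> D + e" using main[OF t] by simp
  qed
  then show ?thesis by (simp add: C_def D_def w_def)
qed

theorem proposition4p12:
  fixes \<Omega> :: "'a::euclidean_space set" and \<alpha> \<beta> :: real
  assumes "convex \<Omega>" and "compact \<Omega>"
    and "\<alpha> > 1" and "\<beta> = \<alpha> - 1"
  shows "\<forall>\<phi>\<in>(Cc_infinity :: ('a \<Rightarrow> real) set). \<exists>C>0.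
    \<forall>\<mu>\<^sub>0\<in>P_on \<Omega>. \<forall>\<mu>\<^sub>1\<in>P_on \<Omega>. \<forall>\<rho>. is_metric_extrapolation \<alpha> \<mu>\<^sub>0 \<mu>\<^sub>1 \<rho> \<longrightarrow>
      \<bar>(\<integral>x. \<phi> x \<partial>\<rho>) - \<alpha> * (\<integral>x. \<phi> x \<partial>\<mu>\<^sub>1) + \<beta> * (\<integral>x. \<phi> x \<partial>\<mu>\<^sub>0)\<bar> \<le> C * (W2 \<mu>\<^sub>0 \<mu>\<^sub>1)\<^sup>2"
proof
  fix \<phi> :: "'a \<Rightarrow> real" assume \<phi>: "\<phi> \<in> Cc_infinity"
  obtain \<psi> S L where \<psi>: "continuous_on UNIV \<psi>" "\<And>x. norm (\<psi> x) \<le> S" and L: "L \<ge> 0"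
    and taylor: "\<And>x y. \<bar>\<phi> y - \<phi> x - \<psi> x \<bullet> (y - x)\<bar> \<le> L * (dist x y)\<^sup>2"
    using Cc_infinity_taylor[OF \<phi>] by blast
  obtain B where B: "\<And>x. \<bar>\<phi> x\<bar> \<le> B" using Cc_infinity_bounded(1)[OF \<phi>] by blast
  have cont: "continuous_on UNIV \<phi>" by (rule Cc_infinity_bounded(2)[OF \<phi>])
  \<comment> \<open>The negative of \<phi> has gradient -\<psi> with the same \<open>L\<close>, so
    both one-sided estimates share the constant \<open>C\<close>.\<close>
  have taylor': "\<bar>- \<phi> y - - \<phi> x - (- \<psi> x) \<bullet> (y - x)\<bar> \<le> L * (dist x y)\<^sup>2" for x y
    using taylor[of y x] by (simp add: abs_minus_commute algebra_simps)
  define C where "C = L * ((1 + 2 * \<beta> + 8 * \<alpha>) * (4 * \<beta>\<^sup>2) + 4 * (\<beta> * (2 * \<beta> + 1)\<^sup>2))"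
  \<comment> \<open>\<open>C\<close> is only known to be nonnegative, as \<open>L\<close> may be 0;
    \<open>C + 1\<close> supplies the strictly positive constant.\<close>
  have "\<bar>(\<integral>x. \<phi> x \<partial>\<rho>) - \<alpha> * (\<integral>x. \<phi> x \<partial>\<mu>\<^sub>1) + \<beta> * (\<integral>x. \<phi> x \<partial>\<mu>\<^sub>0)\<bar> \<le> (C + 1) * (W2 \<mu>\<^sub>0 \<mu>\<^sub>1)\<^sup>2"
    if "\<mu>\<^sub>0 \<in> P_on \<Omega>" "\<mu>\<^sub>1 \<in> P_on \<Omega>" and \<rho>: "is_metric_extrapolation \<alpha> \<mu>\<^sub>0 \<mu>\<^sub>1 \<rho>" for \<mu>\<^sub>0 \<mu>\<^sub>1 \<rho>
  proof -
    have \<mu>: "\<mu>\<^sub>0 \<in> P2" "\<mu>\<^sub>1 \<in> P2" using that by (auto simp: P_on_def)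
    note one_sided = metric_extrapolation_one_sided[OF assms(3,4) \<mu> \<rho> _ _ _ _ L, folded C_def]
    have "- C * (W2 \<mu>\<^sub>0 \<mu>\<^sub>1)\<^sup>2 \<le> (\<integral>x. \<phi> x \<partial>\<rho>) - \<alpha> * (\<integral>x. \<phi> x \<partial>\<mu>\<^sub>1) + \<beta> * (\<integral>x. \<phi> x \<partial>\<mu>\<^sub>0)"
      by (rule one_sided[OF cont B \<psi> taylor])
    moreover have "- C * (W2 \<mu>\<^sub>0 \<mu>\<^sub>1)\<^sup>2
        \<le> (\<integral>x. - \<phi> x \<partial>\<rho>) - \<alpha> * (\<integral>x. - \<phi> x \<partial>\<mu>\<^sub>1) + \<beta> * (\<integral>x. - \<phi> x \<partial>\<mu>\<^sub>0)"
      by (rule one_sided[of "\<lambda>x. - \<phi> x" B "\<lambda>x. - \<psi> x" S])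
        (use cont B \<psi> taylor' in \<open>auto intro: continuous_on_minus\<close>)
    ultimately have "\<bar>(\<integral>x. \<phi> x \<partial>\<rho>) - \<alpha> * (\<integral>x. \<phi> x \<partial>\<mu>\<^sub>1) + \<beta> * (\<integral>x. \<phi> x \<partial>\<mu>\<^sub>0)\<bar> \<le> C * (W2 \<mu>\<^sub>0 \<mu>\<^sub>1)\<^sup>2"
      by simp
    also have "\<dots> \<le> (C + 1) * (W2 \<mu>\<^sub>0 \<mu>\<^sub>1)\<^sup>2" by (intro mult_right_mono) auto
    finally show ?thesis .
  qed
  moreover have "C + 1 > 0"
  proof -
    have "C \<ge> 0" unfolding C_def using L assms(3,4) by (intro mult_nonneg_nonneg add_nonneg_nonneg) auto
    then show ?thesis by simp
  qed
  ultimately show "\<exists>C>0. \<forall>\<mu>\<^sub>0\<in>P_on \<Omega>. \<forall>\<mu>\<^sub>1\<in>P_on \<Omega>. \<forall>\<rho>. is_metric_extrapolation \<alpha> \<mu>\<^sub>0 \<mu>\<^sub>1 \<rho> \<longrightarrow>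
      \<bar>(\<integral>x. \<phi> x \<partial>\<rho>) - \<alpha> * (\<integral>x. \<phi> x \<partial>\<mu>\<^sub>1) + \<beta> * (\<integral>x. \<phi> x \<partial>\<mu>\<^sub>0)\<bar> \<le> C * (W2 \<mu>\<^sub>0 \<mu>\<^sub>1)\<^sup>2"
    by (intro exI[of _ "C + 1"]) auto
qed

end
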